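(* Let $k$ be a field of characteristic zero and $H=\langle x,y\mid [[y,x],x]=[[y,x],y]=0\rangle$ the Heisenberg Lie $k$-algebra. Let $\mathfrak{D}(H)$ be the Ore division ring of fractions of $U(H)$. Set $z=[y,x]$, $V=\tfrac12 z(xy+yx)z$, and $$S=(V-\tfrac13z^3)(V+\tfrac13z^3)^{-1}+(V-\tfrac13z^3)^{-1}(V+\tfrac13z^3),\qquad T=(z+y^2)^{-1}(z-y^2)\,S\,(z+y^2)(z-y^2)^{-1}.$$ Then (1) the $k$-subalgebra of $\mathfrak{D}(H)$ generated by $S$ and $T$ is the free $k$-algebra on $\{S,T\}$ (in particular all the displayed inverses exist), and (2) $S$ and $T$ are symmetric, i.e. $S^*=S$, $T^*=T$, for the principal involution $*$ on $\mathfrak{D}(H)$.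
   Context: $U(H)$ is an Ore domain. The principal involution of $U(H)$ is the unique $k$-linear anti-automorphism of order two with $a^*=-a$ for $a\in H$; it extends uniquely to an involution of the Ore division ring of fractions $\mathfrak{D}(H)$ (with $(f^{-1})^*=(f^* )^{-1}$). The free $k$-algebra on a set $X$ is the algebra of noncommutative polynomials in $X$. *)

theory Defs
  imports Main
begin

text \<open>An element of the free k-algebra on two generators is a finitely supported
  function from words to coefficients. A word is a list of booleans; True stands
  for the first generator, False for the second.\<close>

type_synonym 'k ncpoly = "bool list \<Rightarrow> 'k"

definition nc_fin :: "'k::zero ncpoly \<Rightarrow> bool" where
  "nc_fin p = finite {w. p w \<noteq> 0}"

definition nc_zero :: "'k::zero ncpoly" where
  "nc_zero = (\<lambda>_. 0)"

definition nc_var :: "bool \<Rightarrow> 'k::zero_neq_one ncpoly" where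
  "nc_var b = (\<lambda>w. if w = [b] then 1 else 0)"

definition nc_add :: "'k::comm_ring_1 ncpoly \<Rightarrow> 'k ncpoly \<Rightarrow> 'k ncpoly" where
  "nc_add p q = (\<lambda>w. p w + q w)"

definition nc_diff :: "'k::comm_ring_1 ncpoly \<Rightarrow> 'k ncpoly \<Rightarrow> 'k ncpoly" where
  "nc_diff p q = (\<lambda>w. p w - q w)"

definition nc_mult :: "'k::comm_ring_1 ncpoly \<Rightarrow> 'k ncpoly \<Rightarrow> 'k ncpoly" where
  "nc_mult p q = (\<lambda>w. \<Sum>i\<le>length w. p (take i w) * q (drop i w))"

definition nc_comm :: "'k::comm_ring_1 ncpoly \<Rightarrow> 'k ncpoly \<Rightarrow> 'k ncpoly" where
  "nc_comm p q = nc_diff (nc_mult p q) (nc_mult q p)"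

inductive_set nc_ideal :: "'k::comm_ring_1 ncpoly set \<Rightarrow> 'k ncpoly set" for R where
  gen: "r \<in> R \<Longrightarrow> r \<in> nc_ideal R"
| zero: "nc_zero \<in> nc_ideal R"
| add: "p \<in> nc_ideal R \<Longrightarrow> q \<in> nc_ideal R \<Longrightarrow> nc_add p q \<in> nc_ideal R"
| mult: "p \<in> nc_ideal R \<Longrightarrow> nc_fin a \<Longrightarrow> nc_fin b \<Longrightarrow>
           nc_mult a (nc_mult p b) \<in> nc_ideal R"

text \<open>Defining relations of the Heisenberg Lie algebra H = <x,y | [[y,x],x] = [[y,x],y] = 0>,
  written in the free algebra k<x,y>; U(H) = k<x,y> / (these relations).
  x is the generator True, y is the generator False.\<close>

definition heis_rels :: "'k::comm_ring_1 ncpoly set" where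
  "heis_rels = (let X = nc_var True; Y = nc_var False in
     {nc_comm (nc_comm Y X) X, nc_comm (nc_comm Y X) Y})"

definition word_eval :: "'d::ring_1 \<Rightarrow> 'd \<Rightarrow> bool list \<Rightarrow> 'd" where
  "word_eval a b w = prod_list (map (\<lambda>c. if c then a else b) w)"

definition nc_eval :: "('k::zero \<Rightarrow> 'd::ring_1) \<Rightarrow> 'd \<Rightarrow> 'd \<Rightarrow> 'k ncpoly \<Rightarrow> 'd" where
  "nc_eval iota a b p = (\<Sum>w\<in>{w. p w \<noteq> 0}. iota (p w) * word_eval a b w)"

definition central_embedding :: "('k::field \<Rightarrow> 'd::ring_1) \<Rightarrow> bool" where
  "central_embedding iota \<longleftrightarrow> iota 1 = 1 \<and>
     (\<forall>a b. iota (a + b) = iota a + iota b) \<and>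
     (\<forall>a b. iota (a * b) = iota a * iota b) \<and>
     (\<forall>c d. iota c * d = d * iota c)"

text \<open>The division ring 'd (a k-algebra via iota) together with x, y is the Ore division
  ring of (right) fractions D(H) of U(H): the k-algebra map U(H) -> 'd sending
  x, y to x, y is well defined and injective (its kernel on k<x,y> is exactly the ideal
  of the Heisenberg relations), and every element of 'd is a b^-1 with a, b in U(H).\<close>

definition is_Ore_fractions_UH :: "('k::field \<Rightarrow> 'd::division_ring) \<Rightarrow> 'd \<Rightarrow> 'd \<Rightarrow> bool" where
  "is_Ore_fractions_UH iota x y \<longleftrightarrow> central_embedding iota \<and>
     (\<forall>p. nc_fin p \<longrightarrow> (nc_eval iota x y p = 0 \<longleftrightarrow> p \<in> nc_ideal heis_rels)) \<and>
     (\<forall>d. \<exists>a b. nc_fin a \<and> nc_fin b \<and> nc_eval iota x y b \<noteq> 0 \<and>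
                d = nc_eval iota x y a * inverse (nc_eval iota x y b))"

definition principal_involution ::
  "('k::field \<Rightarrow> 'd::division_ring) \<Rightarrow> 'd \<Rightarrow> 'd \<Rightarrow> ('d \<Rightarrow> 'd) \<Rightarrow> bool" where
  "principal_involution iota x y star \<longleftrightarrow>
     (\<forall>a b. star (a + b) = star a + star b) \<and>
     (\<forall>a b. star (a * b) = star b * star a) \<and>
     (\<forall>c a. star (iota c * a) = iota c * star a) \<and>
     (\<forall>a. star (star a) = a) \<and>
     star x = - x \<and> star y = - y"

definition heis_z :: "'d::ring_1 \<Rightarrow> 'd \<Rightarrow> 'd" where
  "heis_z x y = y * x - x * y"

definition heis_V :: "('k::field \<Rightarrow> 'd::division_ring) \<Rightarrow> 'd \<Rightarrow> 'd \<Rightarrow> 'd" where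
  "heis_V iota x y = iota (1/2) * heis_z x y * (x * y + y * x) * heis_z x y"

definition heis_Vm :: "('k::field \<Rightarrow> 'd::division_ring) \<Rightarrow> 'd \<Rightarrow> 'd \<Rightarrow> 'd" where
  "heis_Vm iota x y = heis_V iota x y - iota (1/3) * heis_z x y ^ 3"

definition heis_Vp :: "('k::field \<Rightarrow> 'd::division_ring) \<Rightarrow> 'd \<Rightarrow> 'd \<Rightarrow> 'd" where
  "heis_Vp iota x y = heis_V iota x y + iota (1/3) * heis_z x y ^ 3"

definition heis_S :: "('k::field \<Rightarrow> 'd::division_ring) \<Rightarrow> 'd \<Rightarrow> 'd \<Rightarrow> 'd" where
  "heis_S iota x y = heis_Vm iota x y * inverse (heis_Vp iota x y)
                     + inverse (heis_Vm iota x y) * heis_Vp iota x y"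

definition heis_T :: "('k::field \<Rightarrow> 'd::division_ring) \<Rightarrow> 'd \<Rightarrow> 'd \<Rightarrow> 'd" where
  "heis_T iota x y = inverse (heis_z x y + y ^ 2) * (heis_z x y - y ^ 2) * heis_S iota x y
                     * (heis_z x y + y ^ 2) * inverse (heis_z x y - y ^ 2)"

end

theory Submission
  imports Defs "HOL-Computational_Algebra.Polynomial"
begin

text \<open>
  Put \<open>N = - V z\<^sup>-\<^sup>3 / 2\<close> and \<open>q = y\<^sup>2 / z\<close>. Then \<open>[N, q] = q\<close>, and with
  \<open>G\<^sub>\<plusminus> = (N \<mp> 1/6)\<^sup>-\<^sup>1\<close>, \<open>u = (1 + q) / (1 - q)\<close> one finds \<open>S = 2 + (G\<^sub>+ - G\<^sub>-) / 3\<close> and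
  \<open>T = u\<^sup>-\<^sup>1 S u\<close>. On \<open>K = k(q)\<close> the derivation \<open>\<delta> = [N, -]\<close> is \<open>q d/dq\<close>, so multiplication by
  \<open>G\<^sub>\<plusminus>\<close> is a twisted integration and words in \<open>S, T\<close> behave like iterated integrals.
  As for hyperlogarithms, their independence, even over \<open>K\<close>, comes from the fact that no nontrivial
  combination of \<open>1\<close> and \<open>u\<close> (or of \<open>1\<close> and \<open>u\<^sup>-\<^sup>1\<close>) with coefficients in \<open>k\<close> is of the form \<open>\<delta> g\<close>
  with \<open>g \<in> K\<close>: it would have a simple pole at \<open>q = 1\<close>, \<open>-1\<close> or \<open>0\<close> with nonzero residue.
  The two letters \<open>G\<^sub>+\<close>, \<open>G\<^sub>-\<close> do not interfere because \<open>\<delta> g = \<plusminus>g/3\<close> has no nonzero solution in \<open>K\<close>.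
\<close>

section \<open>Evaluation of noncommutative polynomials\<close>

definition nc_ord_ge :: "nat \<Rightarrow> 'k::zero ncpoly \<Rightarrow> bool" where
  "nc_ord_ge n p \<longleftrightarrow> (\<forall>w. length w < n \<longrightarrow> p w = 0)"

lemma nc_ord_ge_mult:
  fixes p q :: "'k::comm_ring_1 ncpoly"
  assumes "nc_ord_ge m p" and "nc_ord_ge n q"
  shows "nc_ord_ge (m + n) (nc_mult p q)"
  unfolding nc_ord_ge_def nc_mult_def
proof (intro allI impI sum.neutral ballI)
  fix w :: "bool list" and i
  assume "length w < m + n" and "i \<in> {..length w}"
  then have "length (take i w) < m \<or> length (drop i w) < n"
    by auto
  then show "p (take i w) * q (drop i w) = 0"
    using assms unfolding nc_ord_ge_def by auto
qed

lemma nc_ord_ge_comm: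
  fixes p q :: "'k::comm_ring_1 ncpoly"
  assumes "nc_ord_ge m p" and "nc_ord_ge n q"
  shows "nc_ord_ge (m + n) (nc_comm p q)"
  using nc_ord_ge_mult[OF assms] nc_ord_ge_mult[OF assms(2,1)]
  by (simp add: nc_comm_def nc_diff_def nc_ord_ge_def add.commute)

lemma nc_ord_ge_var: "nc_ord_ge 1 (nc_var b)"
  by (simp add: nc_ord_ge_def nc_var_def)

text \<open>The relations are double commutators of generators, hence of degree 3, and two-sided
  multiplication never lowers the order. So the quadratic element [y,x] stays outside the ideal,
  which gives z nonzero.\<close>

lemma nc_ord_ge_heis_ideal:
  fixes p :: "'k::comm_ring_1 ncpoly"
  assumes "p \<in> nc_ideal heis_rels"
  shows "nc_ord_ge 3 p"
  using assms
proof induction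
  case (gen r)
  have "nc_ord_ge (1 + 1 + 1) (nc_comm (nc_comm (nc_var False) (nc_var True)) (nc_var b))" for b
    by (intro nc_ord_ge_comm nc_ord_ge_var)
  then show ?case
    using gen by (auto simp: heis_rels_def Let_def eval_nat_numeral)
next
  case (mult p a b)
  have "nc_ord_ge 0 a" "nc_ord_ge 0 b"
    by (simp_all add: nc_ord_ge_def)
  then have "nc_ord_ge (0 + (3 + 0)) (nc_mult a (nc_mult p b))"
    using mult.IH by (intro nc_ord_ge_mult)
  then show ?case by simp
qed (auto simp: nc_ord_ge_def nc_zero_def nc_add_def)

lemma nc_comm_not_heis_ideal:
  "nc_comm (nc_var False) (nc_var True) \<notin> nc_ideal (heis_rels :: 'k::comm_ring_1 ncpoly set)"
proof
  assume "nc_comm (nc_var False) (nc_var True) \<in> nc_ideal (heis_rels :: 'k ncpoly set)"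
  then have "nc_comm (nc_var False) (nc_var True) [False, True] = (0 :: 'k)"
    using nc_ord_ge_heis_ideal unfolding nc_ord_ge_def by fastforce
  then show False
    by (simp add: nc_comm_def nc_diff_def nc_mult_def nc_var_def numeral_2_eq_2)
qed

text \<open>Pairs of words from the two supports replace the cut positions of \<open>w\<close>, so
  that the range no longer depends on \<open>w\<close> and \<open>nc_eval_mult\<close> can
  interchange sums.\<close>

lemma nc_mult_eq_sum:
  fixes p q :: "'k::comm_ring_1 ncpoly"
  assumes "nc_fin p" and "nc_fin q"
  shows "nc_mult p q w =
    (\<Sum>(u, v) \<in> {u. p u \<noteq> 0} \<times> {v. q v \<noteq> 0}. if u @ v = w then p u * q v else 0)"
proof -
  let ?h = "\<lambda>i. (take i w, drop i w)"
  have inj: "inj_on ?h {..length w}"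
    by (rule inj_onI) (auto dest: arg_cong[where f = length])
  have img: "?h ` {..length w} = {(u, v). u @ v = w}"
  proof (intro equalityI subsetI)
    fix a assume "a \<in> {(u, v). u @ v = w}"
    then obtain u v where "a = (u, v)" "u @ v = w" by auto
    then show "a \<in> ?h ` {..length w}"
      by (intro image_eqI[where x = "length u"]) auto
  qed auto
  have fin: "finite {(u, v). u @ v = w}"
    by (subst img[symmetric]) simp
  have "nc_mult p q w = (\<Sum>(u, v) \<in> {(u, v). u @ v = w}. p u * q v)"
    unfolding img[symmetric] nc_mult_def by (simp add: sum.reindex[OF inj])
  also have "\<dots> = (\<Sum>(u, v) \<in> {(u, v). u @ v = w} \<inter> {u. p u \<noteq> 0} \<times> {v. q v \<noteq> 0}. p u * q v)"
    by (rule sum.mono_neutral_right[OF fin]) auto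
  also have "\<dots> = (\<Sum>(u, v) \<in> {u. p u \<noteq> 0} \<times> {v. q v \<noteq> 0}. if u @ v = w then p u * q v else 0)"
    using assms unfolding nc_fin_def
    by (intro sum.mono_neutral_cong_left) (auto split: if_splits)
  finally show ?thesis .
qed

lemma nc_mult_support:
  fixes p q :: "'k::comm_ring_1 ncpoly"
  assumes "nc_fin p" and "nc_fin q"
  shows "{w. nc_mult p q w \<noteq> 0} \<subseteq> (\<lambda>(u, v). u @ v) ` ({u. p u \<noteq> 0} \<times> {v. q v \<noteq> 0})"
proof
  fix w assume "w \<in> {w. nc_mult p q w \<noteq> 0}"
  then obtain a where a: "a \<in> {u. p u \<noteq> 0} \<times> {v. q v \<noteq> 0}"
      and "(case a of (u, v) \<Rightarrow> if u @ v = w then p u * q v else 0) \<noteq> 0"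
    unfolding nc_mult_eq_sum[OF assms] mem_Collect_eq
    by (rule sum.not_neutral_contains_not_neutral)
  then have "w = (\<lambda>(u, v). u @ v) a"
    by (auto split: if_splits)
  with a show "w \<in> (\<lambda>(u, v). u @ v) ` ({u. p u \<noteq> 0} \<times> {v. q v \<noteq> 0})"
    by (rule rev_image_eqI)
qed

lemma nc_fin_mult: "nc_fin p \<Longrightarrow> nc_fin q \<Longrightarrow> nc_fin (nc_mult p q)"
  using nc_mult_support[of p q] unfolding nc_fin_def
  by (meson finite_SigmaI finite_imageI finite_subset)

lemma nc_fin_diff: "nc_fin p \<Longrightarrow> nc_fin q \<Longrightarrow> nc_fin (nc_diff p q)"
  unfolding nc_fin_def nc_diff_def
  by (rule finite_subset[of _ "{w. p w \<noteq> 0} \<union> {w. q w \<noteq> 0}"]) auto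

lemma nc_fin_comm: "nc_fin p \<Longrightarrow> nc_fin q \<Longrightarrow> nc_fin (nc_comm p q)"
  by (simp add: nc_comm_def nc_fin_diff nc_fin_mult)

lemma nc_fin_var: "nc_fin (nc_var b)"
  by (simp add: nc_fin_def nc_var_def)

lemma word_eval_append: "word_eval a b (u @ v) = word_eval a b u * word_eval a b v"
  by (simp add: word_eval_def)

lemma word_eval_Nil [simp]: "word_eval a b [] = 1"
  by (simp add: word_eval_def)

lemma word_eval_Cons: "word_eval a b (c # w) = (if c then a else b) * word_eval a b w"
  by (simp add: word_eval_def)

section \<open>Evaluation as an algebra homomorphism\<close>

locale central_embed =
  fixes iota :: "'k::field_char_0 \<Rightarrow> 'd::division_ring"
  assumes central: "central_embedding iota"
begin

lemma iota_1 [simp]: "iota 1 = 1"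
  and iota_add: "iota (a + b) = iota a + iota b"
  and iota_mult: "iota (a * b) = iota a * iota b"
  and iota_commute: "iota c * d = d * iota c"
  using central unfolding central_embedding_def by blast+

lemma iota_0 [simp]: "iota 0 = 0"
  using iota_add[of 0 0] by simp

lemma iota_minus: "iota (- a) = - iota a"
  using iota_add[of a "- a"] by (simp add: eq_neg_iff_add_eq_0 add.commute)

lemma iota_diff: "iota (a - b) = iota a - iota b"
  using iota_add[of a "- b"] by (simp add: iota_minus)

lemma iota_eq_0_iff [simp]: "iota a = 0 \<longleftrightarrow> a = 0"
proof
  assume a: "iota a = 0"
  show "a = 0"
  proof (rule ccontr)
    assume "a \<noteq> 0"
    then have "iota 1 = iota a * iota (inverse a)"
      by (simp flip: iota_mult)
    then show False by (simp only: a iota_1) simp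
  qed
qed simp

lemma iota_left_commute: "d * (iota c * e) = iota c * (d * e)"
  by (metis iota_commute mult.assoc)

lemma iota_mult_mult: "iota (c * d) * (a * b) = (iota c * a) * (iota d * b)"
  unfolding iota_mult mult.assoc by (subst iota_left_commute[of a d b]) (rule refl)

lemma iota_sum: "iota (sum f A) = (\<Sum>x\<in>A. iota (f x))"
  by (induction A rule: infinite_finite_induct) (auto simp: iota_add)

lemma iota_of_nat: "iota (of_nat n) = of_nat n"
  by (induction n) (auto simp: iota_add)

lemma iota_numeral: "iota (numeral n) = numeral n"
  using iota_of_nat[of "numeral n"] by simp

lemma nc_eval_superset:
  assumes "finite A" and "{w. p w \<noteq> 0} \<subseteq> A"
  shows "nc_eval iota a b p = (\<Sum>w\<in>A. iota (p w) * word_eval a b w)"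
  unfolding nc_eval_def using assms by (intro sum.mono_neutral_left) auto

lemma nc_eval_diff:
  assumes "nc_fin p" and "nc_fin q"
  shows "nc_eval iota a b (nc_diff p q) = nc_eval iota a b p - nc_eval iota a b q"
proof -
  let ?A = "{w. p w \<noteq> 0} \<union> {w. q w \<noteq> 0}"
  have A: "finite ?A"
    using assms by (simp add: nc_fin_def)
  have "nc_eval iota a b (nc_diff p q) = (\<Sum>w\<in>?A. iota (nc_diff p q w) * word_eval a b w)"
    by (rule nc_eval_superset[OF A]) (auto simp: nc_diff_def)
  also have "\<dots> = nc_eval iota a b p - nc_eval iota a b q"
    by (simp add: nc_eval_superset[OF A] nc_diff_def iota_diff left_diff_distrib sum_subtractf)
  finally show ?thesis .
qed

lemma nc_eval_mult:
  assumes "nc_fin p" and "nc_fin q"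
  shows "nc_eval iota a b (nc_mult p q) = nc_eval iota a b p * nc_eval iota a b q"
proof -
  let ?P = "{w. p w \<noteq> 0}" and ?Q = "{w. q w \<noteq> 0}"
  let ?W = "(\<lambda>(u, v). u @ v) ` (?P \<times> ?Q)"
  have W: "finite ?W" and PQ: "finite ?P" "finite ?Q"
    using assms by (simp_all add: nc_fin_def)
  have "nc_eval iota a b (nc_mult p q) = (\<Sum>w\<in>?W. iota (nc_mult p q w) * word_eval a b w)"
    by (rule nc_eval_superset[OF W nc_mult_support[OF assms]])
  also have "\<dots> = (\<Sum>w\<in>?W. \<Sum>(u, v)\<in>?P \<times> ?Q.
      if u @ v = w then iota (p u * q v) * word_eval a b w else 0)"
    by (auto simp: nc_mult_eq_sum[OF assms] iota_sum sum_distrib_right intro!: sum.cong)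
  also have "\<dots> = (\<Sum>(u, v)\<in>?P \<times> ?Q. \<Sum>w\<in>?W.
      if u @ v = w then iota (p u * q v) * word_eval a b w else 0)"
    by (subst sum.swap) (simp add: case_prod_beta')
  also have "\<dots> = (\<Sum>(u, v)\<in>?P \<times> ?Q. iota (p u * q v) * word_eval a b (u @ v))"
  proof (rule sum.cong[OF refl], clarify)
    fix u v assume "p u \<noteq> 0" "q v \<noteq> 0"
    then have "u @ v \<in> ?W" by auto
    then show "(\<Sum>w\<in>?W. if u @ v = w then iota (p u * q v) * word_eval a b w else 0) =
        iota (p u * q v) * word_eval a b (u @ v)"
      using W by (subst sum.delta') auto
  qed
  also have "\<dots> = nc_eval iota a b p * nc_eval iota a b q"
    unfolding nc_eval_def sum_product sum.cartesian_product
    by (intro sum.cong) (auto simp: word_eval_append iota_mult_mult)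
  finally show ?thesis .
qed

lemma nc_eval_comm:
  assumes "nc_fin p" and "nc_fin q"
  shows "nc_eval iota a b (nc_comm p q) =
    nc_eval iota a b p * nc_eval iota a b q - nc_eval iota a b q * nc_eval iota a b p"
  using assms by (simp add: nc_comm_def nc_eval_diff nc_eval_mult nc_fin_mult)

lemma nc_eval_var: "nc_eval iota a b (nc_var c) = (if c then a else b)"
proof -
  have "nc_eval iota a b (nc_var c) = (\<Sum>w\<in>{[c]}. iota (nc_var c w) * word_eval a b w)"
    by (rule nc_eval_superset) (auto simp: nc_var_def)
  then show ?thesis
    by (simp add: nc_var_def word_eval_def)
qed

end

text \<open>The kernel condition is used in both directions: [y,x] is not in the ideal, while its
  commutators with x and y are generators of it.\<close>

lemma heis_z_nonzero_central:
  fixes iota :: "'k::field_char_0 \<Rightarrow> 'd::division_ring"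
  assumes "is_Ore_fractions_UH iota x y"
  shows "heis_z x y \<noteq> 0" and "heis_z x y * x = x * heis_z x y"
    and "heis_z x y * y = y * heis_z x y"
proof -
  interpret central_embed iota
    using assms by unfold_locales (simp add: is_Ore_fractions_UH_def)
  let ?X = "nc_var True :: 'k ncpoly" and ?Y = "nc_var False :: 'k ncpoly"
  have ker: "nc_fin p \<Longrightarrow> nc_eval iota x y p = 0 \<longleftrightarrow> p \<in> nc_ideal heis_rels" for p
    using assms by (simp add: is_Ore_fractions_UH_def)
  have z: "nc_eval iota x y (nc_comm ?Y ?X) = heis_z x y"
    by (simp add: nc_eval_comm nc_fin_var nc_eval_var heis_z_def)
  show "heis_z x y \<noteq> 0"
    using ker[of "nc_comm ?Y ?X"] nc_comm_not_heis_ideal[where 'k = 'k]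
    by (simp add: z nc_fin_comm nc_fin_var)
  have "nc_eval iota x y (nc_comm (nc_comm ?Y ?X) (nc_var b)) = 0" for b
  proof -
    have "nc_comm (nc_comm ?Y ?X) (nc_var b) \<in> heis_rels"
      by (cases b) (simp_all add: heis_rels_def Let_def)
    then show ?thesis
      by (simp add: ker nc_fin_comm nc_fin_var nc_ideal.gen)
  qed
  from this[of True] this[of False]
  show "heis_z x y * x = x * heis_z x y" and "heis_z x y * y = y * heis_z x y"
    by (simp_all add: nc_eval_comm nc_fin_comm nc_fin_var nc_eval_var z)
qed

section \<open>Rational functions of \<open>q\<close> and the derivation \<open>[N, -]\<close>\<close>

lemma inverse_commute: "a * b = b * a \<Longrightarrow> inverse a * b = b * inverse a" for a b :: "'d::division_ring"
proof (cases "a = 0")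
  case False
  assume ab: "a * b = b * a"
  have "inverse a * b = inverse a * (b * a) * inverse a"
    using False by (simp add: mult.assoc)
  also have "\<dots> = b * inverse a"
    using False by (simp flip: ab mult.assoc)
  finally show ?thesis .
qed simp

text \<open>For g = a/b the equation reads f g' = h/(X - r). In characteristic zero a pole of g of
  order k > 0 becomes a pole of g' of order k + 1, so a derivative never has a simple pole.\<close>

lemma wronskian_simple_pole:
  fixes a b f h :: "'k::field_char_0 poly"
  assumes b: "b \<noteq> 0" and nocommon: "\<not> (poly a r = 0 \<and> poly b r = 0)" and f: "poly f r \<noteq> 0"
    and eq: "[:-r, 1:] * f * (b * pderiv a - a * pderiv b) = h * b\<^sup>2"
  shows "poly h r = 0"
proof (cases "poly b r = 0")
  case False
  then show ?thesis
    using arg_cong[OF eq, of "\<lambda>p. poly p r"] by simp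
next
  case True
  define X where "X = [:-r, 1:]"
  have X0: "X \<noteq> 0"
    by (simp add: X_def)
  obtain c where c: "b = X ^ order r b * c" "\<not> X dvd c"
    using order_decomp[OF b] unfolding X_def by blast
  obtain m where m: "order r b = Suc m"
    using True b by (metis not0_implies_Suc order_root)
  have bc: "b = X ^ Suc m * c"
    using c(1) m by simp
  have dX: "pderiv (X ^ Suc m) = smult (of_nat (Suc m)) (X ^ m)"
    unfolding pderiv_power_Suc X_def by (simp add: pderiv_pCons)
  have "X ^ Suc m * (f * (X * c * pderiv a - a * (X * pderiv c + smult (of_nat (Suc m)) c))) =
      X * f * (b * pderiv a - a * pderiv b)"
    unfolding bc pderiv_mult dX by (simp add: algebra_simps smult_add_right)
  also have "\<dots> = X ^ Suc m * (h * (X ^ Suc m * c\<^sup>2))"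
    unfolding X_def eq unfolding X_def[symmetric] bc by (simp add: algebra_simps power2_eq_square)
  finally have "f * (X * c * pderiv a - a * (X * pderiv c + smult (of_nat (Suc m)) c)) =
      h * (X ^ Suc m * c\<^sup>2)"
    using X0 by (subst (asm) mult_left_cancel) simp_all
  \<comment> \<open>The right side keeps a factor \<open>X\<close>, so at r only the term with f, a,
    m + 1 and c survives; none of these four factors vanishes unless a hypothesis fails.\<close>
  from arg_cong[OF this, of "\<lambda>p. poly p r"]
  have "poly f r * (poly a r * (of_nat (Suc m) * poly c r)) = 0"
    by (simp add: X_def)
  then show ?thesis
    using True nocommon f c(2) of_nat_neq_0[of m, where 'a = 'k]
    by (auto simp: poly_eq_0_iff_dvd X_def simp del: of_nat_Suc)
qed

text \<open>For g = a/b this is X g' = lam g. At infinity g grows like X^(deg a - deg b), and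
  comparing top coefficients makes lam that integer.\<close>

lemma wronskian_eigen:
  fixes a b :: "'k::field_char_0 poly"
  assumes "b \<noteq> 0" and "lam \<notin> \<int>"
    and eq: "[:0, 1:] * (b * pderiv a - a * pderiv b) = smult lam (a * b)"
  shows "a = 0"
proof (rule ccontr)
  assume "a \<noteq> 0"
  have lc: "coeff (pCons 0 (pderiv p)) (degree p) = of_nat (degree p) * lead_coeff p"
    for p :: "'k poly"
    by (cases "degree p") (auto simp: coeff_pderiv coeff_pCons)
  have top: "coeff (p * pCons 0 (pderiv r)) (degree p + degree r) =
      of_nat (degree r) * (lead_coeff p * lead_coeff r)" for p r :: "'k poly"
  proof (cases "degree r = 0")
    case True
    then have "pderiv r = 0"
      by (simp add: pderiv_eq_0_iff)
    with True show ?thesis by simp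
  next
    case False
    then have "degree (pCons 0 (pderiv r)) = degree r"
      by (simp add: degree_pCons_eq_if degree_pderiv pderiv_eq_0_iff)
    then show ?thesis
      using coeff_mult_degree_sum[of p "pCons 0 (pderiv r)"] by (simp only: lc mult.left_commute)
  qed
  have "b * pCons 0 (pderiv a) - a * pCons 0 (pderiv b) = smult lam (a * b)"
    using eq by (simp add: algebra_simps)
  from arg_cong[OF this, of "\<lambda>p. coeff p (degree a + degree b)"]
  have "(of_nat (degree a) - of_nat (degree b)) * (lead_coeff a * lead_coeff b) =
      lam * (lead_coeff a * lead_coeff b)"
    using top[of a b] top[of b a]
    by (simp only: coeff_diff coeff_smult coeff_mult_degree_sum left_diff_distrib add.commute
        mult.commute)
  then have "lam = of_int (int (degree a) - int (degree b))"
    using \<open>a \<noteq> 0\<close> \<open>b \<noteq> 0\<close> by simp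
  then show False
    using \<open>lam \<notin> \<int>\<close> by (metis Ints_of_int)
qed

section \<open>Polynomials in q when [N, q] = q\<close>

locale weyl_pair = central_embed iota for iota :: "'k::field_char_0 \<Rightarrow> 'd::division_ring" +
  fixes N q :: 'd
  assumes Nq: "N * q - q * N = q" and q_nonzero: "q \<noteq> 0"
begin

definition ev :: "'k poly \<Rightarrow> 'd" where
  "ev = (\<lambda>p. fold_coeffs (\<lambda>c d. iota c + q * d) p 0)"

lemma ev_0 [simp]: "ev 0 = 0"
  by (simp add: ev_def)

lemma ev_pCons [simp]: "ev (pCons c p) = iota c + q * ev p"
  by (cases "c = 0 \<and> p = 0") (auto simp: ev_def)

lemma ev_1 [simp]: "ev 1 = 1"
  by (simp add: one_pCons)

lemma ev_add: "ev (p + r) = ev p + ev r"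
  by (induction p r rule: poly_induct2) (simp_all add: iota_add algebra_simps)

lemma ev_smult: "ev (smult c p) = iota c * ev p"
  by (induction p) (simp_all add: iota_mult distrib_left iota_left_commute mult.assoc)

lemma ev_mult: "ev (p * r) = ev p * ev r"
  by (induction p) (simp_all add: ev_add ev_smult algebra_simps)

lemma ev_minus: "ev (- p) = - ev p"
  using ev_add[of p "- p"] by (simp add: eq_neg_iff_add_eq_0 add.commute)

lemma ev_diff: "ev (p - r) = ev p - ev r"
  using ev_add[of p "- r"] by (simp add: ev_minus)

lemma ev_commute: "ev p * ev r = ev r * ev p"
  by (simp flip: ev_mult add: mult.commute)

definition \<delta> :: "'d \<Rightarrow> 'd" where
  "\<delta> g = N * g - g * N"

lemma delta_add: "\<delta> (g + h) = \<delta> g + \<delta> h"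
  and delta_mult: "\<delta> (g * h) = \<delta> g * h + g * \<delta> h"
  by (simp_all add: \<delta>_def algebra_simps)

lemma delta_iota [simp]: "\<delta> (iota c) = 0"
  by (simp add: \<delta>_def iota_commute)

lemma delta_0 [simp]: "\<delta> 0 = 0"
  and delta_1 [simp]: "\<delta> 1 = 0"
  by (simp_all add: \<delta>_def)

lemma delta_q: "\<delta> q = q"
  by (simp add: \<delta>_def Nq)

lemma delta_ev: "\<delta> (ev p) = q * ev (pderiv p)"
proof (induction p)
  case (pCons c p)
  then show ?case
    by (simp add: delta_add delta_mult delta_q pderiv_pCons ev_add algebra_simps)
qed simp

text \<open>This is the transcendence of q over k: \<delta> maps p(q) to q p'(q), so a relation for
  p gives one for p' of smaller degree, until p is constant.\<close>

lemma ev_eq_0_iff [simp]: "ev p = 0 \<longleftrightarrow> p = 0"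
proof
  show "ev p = 0 \<Longrightarrow> p = 0"
  proof (induction "degree p" arbitrary: p rule: less_induct)
    case less
    have "ev (pderiv p) = 0"
      using delta_ev[of p] less.prems q_nonzero by simp
    then have "pderiv p = 0"
      using less.hyps[of "pderiv p"] by (cases "degree p = 0") (auto simp: degree_pderiv pderiv_eq_0_iff)
    then obtain c where "p = [:c:]"
      by (metis pderiv_eq_0_iff degree_eq_zeroE)
    then show ?case
      using less.prems by simp
  qed
qed simp

section \<open>The field k(q) inside the division ring\<close>

definition K :: "'d set" where
  "K = {ev a * inverse (ev b) | a b. b \<noteq> 0}"

lemma K_iff: "g \<in> K \<longleftrightarrow> (\<exists>a b. b \<noteq> 0 \<and> g * ev b = ev a)"
proof
  assume "g \<in> K"
  then obtain a b where "b \<noteq> 0" "g = ev a * inverse (ev b)"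
    by (auto simp: K_def)
  then have "g * ev b = ev a"
    by (simp add: mult.assoc)
  with \<open>b \<noteq> 0\<close> show "\<exists>a b. b \<noteq> 0 \<and> g * ev b = ev a" by blast
next
  assume "\<exists>a b. b \<noteq> 0 \<and> g * ev b = ev a"
  then obtain a b where b: "b \<noteq> 0" and "g * ev b = ev a" by blast
  then have "g = ev a * inverse (ev b)"
    by (metis ev_eq_0_iff mult.assoc mult_1_right right_inverse)
  with b show "g \<in> K" by (auto simp: K_def)
qed

lemma K_commute_ev:
  assumes "g \<in> K"
  shows "g * ev p = ev p * g"
proof -
  obtain a b where g: "g = ev a * inverse (ev b)"
    using assms by (auto simp: K_def)
  have "inverse (ev b) * ev p = ev p * inverse (ev b)"
    by (rule inverse_commute[OF ev_commute])
  then show ?thesis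
    unfolding g by (metis ev_commute mult.assoc)
qed

lemma K_commute:
  assumes "g \<in> K" and "h \<in> K"
  shows "g * h = h * g"
proof -
  obtain a b where h: "h = ev a * inverse (ev b)"
    using assms by (auto simp: K_def)
  have "inverse (ev b) * g = g * inverse (ev b)"
    using inverse_commute[OF K_commute_ev[OF assms(1), symmetric]] .
  then show ?thesis
    unfolding h by (metis K_commute_ev[OF assms(1)] mult.assoc)
qed

lemma K_ev [simp]: "ev a \<in> K"
  unfolding K_iff by (intro exI[of _ a] exI[of _ 1]) simp

lemma K_iota [simp]: "iota c \<in> K"
  using K_ev[of "[:c:]"] by simp

lemma K_q [simp]: "q \<in> K"
  using K_ev[of "[:0, 1:]"] by simp

lemma K_0 [simp]: "0 \<in> K" and K_1 [simp]: "1 \<in> K"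
  using K_ev[of 0] K_ev[of 1] by simp_all

lemma K_add [intro]:
  assumes "g \<in> K" and "h \<in> K"
  shows "g + h \<in> K"
proof -
  obtain a b c d where "b \<noteq> 0" "d \<noteq> 0" and g: "g * ev b = ev a" and h: "h * ev d = ev c"
    using assms by (auto simp: K_iff)
  moreover have "(g + h) * ev (b * d) = ev (a * d + c * b)"
  proof -
    have "(g + h) * ev (b * d) = g * ev b * ev d + h * ev d * ev b"
      by (simp only: ev_mult distrib_right mult.assoc ev_commute[of b d])
    then show ?thesis
      by (simp only: g h ev_add ev_mult)
  qed
  ultimately show ?thesis
    unfolding K_iff by (intro exI[of _ "a * d + c * b"] exI[of _ "b * d"]) simp
qed

lemma K_mult [intro]:
  assumes "g \<in> K" and "h \<in> K"
  shows "g * h \<in> K"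
proof -
  obtain a b c d where "b \<noteq> 0" "d \<noteq> 0" and g: "g * ev b = ev a" and h: "h * ev d = ev c"
    using assms by (auto simp: K_iff)
  moreover have "(g * h) * ev (d * b) = ev (a * c)"
  proof -
    have "(g * h) * ev (d * b) = g * (h * ev d) * ev b"
      by (simp only: ev_mult mult.assoc)
    also have "\<dots> = g * ev b * ev c"
      by (simp only: h mult.assoc ev_commute)
    finally show ?thesis
      by (simp only: g ev_mult)
  qed
  ultimately show ?thesis
    unfolding K_iff by (intro exI[of _ "a * c"] exI[of _ "d * b"]) simp
qed

lemma K_minus [intro]: "g \<in> K \<Longrightarrow> - g \<in> K"
  using K_mult[OF K_iota[of "- 1"], of g] by (simp add: iota_minus)

lemma K_diff [intro]: "g \<in> K \<Longrightarrow> h \<in> K \<Longrightarrow> g - h \<in> K"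
  using K_add[OF _ K_minus, of g h] by simp

lemma K_inverse [intro]:
  assumes "g \<in> K"
  shows "inverse g \<in> K"
proof (cases "g = 0")
  case False
  obtain a b where "b \<noteq> 0" and g: "g * ev b = ev a"
    using assms by (auto simp: K_iff)
  then have "a \<noteq> 0"
    using False by auto
  moreover have "inverse g * ev a = ev b"
    using False by (simp flip: g mult.assoc)
  ultimately show ?thesis
    unfolding K_iff by blast
qed simp

text \<open>A denominator of minimal degree has no root in common with its numerator, as the linear
  factor could be cancelled. The minimality serves \<open>delta_K_eq_0\<close>, the coprimality at
  roots serves the pole arguments.\<close>

lemma K_reduced:
  assumes "g \<in> K"
  obtains a b where "b \<noteq> 0" and "g * ev b = ev a"
    and "\<And>a' b'. b' \<noteq> 0 \<Longrightarrow> g * ev b' = ev a' \<Longrightarrow> degree b \<le> degree b'"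
    and "\<And>r. \<not> (poly a r = 0 \<and> poly b r = 0)"
proof -
  define P where "P = (\<lambda>b. b \<noteq> 0 \<and> (\<exists>a. g * ev b = ev a))"
  obtain b0 where "P b0"
    using assms by (auto simp: K_iff P_def)
  then obtain b where b: "P b" and min: "\<And>b'. P b' \<Longrightarrow> degree b \<le> degree b'"
    using arg_min_natI[of P b0 degree] arg_min_nat_le[of P _ degree] by blast
  from b obtain a where b0: "b \<noteq> 0" and a: "g * ev b = ev a"
    by (auto simp: P_def)
  have "\<not> (poly a r = 0 \<and> poly b r = 0)" for r
  proof
    assume "poly a r = 0 \<and> poly b r = 0"
    then obtain a1 b1 where ab: "a = a1 * [:-r, 1:]" "b = b1 * [:-r, 1:]"
      by (auto simp: poly_eq_0_iff_dvd dvd_def mult.commute)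
    have "g * ev b1 * ev [:-r, 1:] = ev a1 * ev [:-r, 1:]"
      using a unfolding ab ev_mult by (simp only: mult.assoc)
    then have "g * ev b1 = ev a1"
      by (subst (asm) mult_right_cancel) (simp_all only: ev_eq_0_iff, simp)
    moreover have "b1 \<noteq> 0"
      using b0 ab by auto
    ultimately have "degree b \<le> degree b1"
      by (intro min) (auto simp: P_def)
    moreover have "degree b = degree b1 + 1"
      using \<open>b1 \<noteq> 0\<close> unfolding ab by (subst degree_mult_eq) auto
    ultimately show False by simp
  qed
  then show ?thesis
    using that[OF b0 a] min by (auto simp: P_def)
qed

section \<open>The derivation on K: constants, eigenvectors and simple poles\<close>

lemma delta_K_ev:
  assumes "g \<in> K" and "g * ev b = ev a"
  shows "\<delta> g * ev (b\<^sup>2) = ev ([:0, 1:] * (b * pderiv a - a * pderiv b))"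
proof -
  have qp: "ev ([:0, 1:] * p) = q * ev p" for p
    by (simp add: ev_mult)
  have "\<delta> g * ev b + g * (q * ev (pderiv b)) = q * ev (pderiv a)"
    using arg_cong[OF assms(2), of \<delta>] by (simp add: delta_mult delta_ev)
  then have "\<delta> g * ev b = ev ([:0, 1:] * pderiv a) - g * ev ([:0, 1:] * pderiv b)"
    unfolding qp by (simp add: algebra_simps)
  then have "\<delta> g * ev b * ev b =
      ev ([:0, 1:] * pderiv a) * ev b - g * ev ([:0, 1:] * pderiv b) * ev b"
    by (simp only: left_diff_distrib)
  also have "g * ev ([:0, 1:] * pderiv b) * ev b = ev a * ev ([:0, 1:] * pderiv b)"
    unfolding assms(2)[symmetric] mult.assoc by (simp only: ev_commute)
  finally have "\<delta> g * ev b * ev b = ev ([:0, 1:] * pderiv a * b - a * ([:0, 1:] * pderiv b))"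
    by (simp only: ev_mult ev_diff)
  then show ?thesis
    by (simp only: power2_eq_square ev_mult mult.assoc right_diff_distrib mult.commute
        mult.left_commute)
qed

lemma K_delta [intro]:
  assumes "g \<in> K"
  shows "\<delta> g \<in> K"
proof -
  obtain a b where b: "b \<noteq> 0" and g: "g * ev b = ev a"
    using assms by (auto simp: K_iff)
  then show ?thesis
    using delta_K_ev[OF assms g] unfolding K_iff by (metis power_not_zero)
qed

lemma ev_inject: "ev p = ev r \<longleftrightarrow> p = r"
  using ev_eq_0_iff[of "p - r"] by (simp add: ev_diff del: ev_eq_0_iff)

text \<open>Applying \<delta> to g b = a gives g b' = a'. Unless b is constant this is a fraction
  with smaller denominator, against minimality.\<close>

lemma delta_K_eq_0:
  assumes "g \<in> K" and "\<delta> g = 0"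
  obtains c where "g = iota c"
proof -
  obtain a b where b: "b \<noteq> 0" and g: "g * ev b = ev a"
    and min: "\<And>a' b'. b' \<noteq> 0 \<Longrightarrow> g * ev b' = ev a' \<Longrightarrow> degree b \<le> degree b'"
    using K_reduced[OF assms(1)] by metis
  have "\<delta> g * ev b + g * (q * ev (pderiv b)) = q * ev (pderiv a)"
    using arg_cong[OF g, of \<delta>] by (simp add: delta_mult delta_ev)
  then have "q * (g * ev (pderiv b)) = q * ev (pderiv a)"
    using K_commute[OF assms(1) K_q] assms(2) by (simp flip: mult.assoc)
  then have eq: "g * ev (pderiv b) = ev (pderiv a)"
    using q_nonzero by simp
  have db: "degree b = 0"
  proof (rule ccontr)
    assume "degree b \<noteq> 0"
    moreover from this have "pderiv b \<noteq> 0"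
      by (simp add: pderiv_eq_0_iff)
    ultimately show False
      using min[OF _ eq] by (simp add: degree_pderiv)
  qed
  then have "pderiv b = 0"
    by (simp add: pderiv_eq_0_iff)
  then have "pderiv a = 0"
    using eq by simp
  then obtain c d where "a = [:c:]" "b = [:d:]"
    using db by (metis pderiv_eq_0_iff degree_eq_zeroE)
  with b g have "d \<noteq> 0" and gd: "g * iota d = iota c"
    by auto
  have "g = g * iota d * iota (inverse d)"
    using \<open>d \<noteq> 0\<close> by (simp add: mult.assoc flip: iota_mult)
  also have "\<dots> = iota (c * inverse d)"
    by (simp add: gd iota_mult)
  finally show ?thesis by (rule that)
qed

lemma delta_K_eigen:
  assumes "g \<in> K" and "lam \<notin> \<int>" and "\<delta> g = iota lam * g"
  shows "g = 0"
proof -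
  obtain a b where b: "b \<noteq> 0" and g: "g * ev b = ev a"
    using assms(1) by (auto simp: K_iff)
  have "ev ([:0, 1:] * (b * pderiv a - a * pderiv b)) = iota lam * (g * ev b * ev b)"
    unfolding delta_K_ev[OF assms(1) g, symmetric] assms(3)
    by (simp only: power2_eq_square ev_mult mult.assoc)
  also have "\<dots> = ev (smult lam (a * b))"
    by (simp only: g ev_smult ev_mult)
  finally have "[:0, 1:] * (b * pderiv a - a * pderiv b) = smult lam (a * b)"
    by (simp only: ev_inject)
  then have "a = 0"
    using wronskian_eigen[OF b assms(2)] by blast
  then show ?thesis
    using g b by simp
qed

text \<open>As \<delta> is q d/dq, this is \<open>wronskian_simple_pole\<close> with f = X, which
  does not vanish at r because r is nonzero.\<close>

lemma delta_K_simple_pole: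
  assumes "g \<in> K" and "r \<noteq> 0" and "\<delta> g * ev [:-r, 1:] = ev h"
  shows "poly h r = 0"
proof -
  obtain a b where b: "b \<noteq> 0" and g: "g * ev b = ev a"
    and nocommon: "\<And>r. \<not> (poly a r = 0 \<and> poly b r = 0)"
    using K_reduced[OF assms(1)] by metis
  have "ev ([:-r, 1:] * [:0, 1:] * (b * pderiv a - a * pderiv b)) =
      ev ([:0, 1:] * (b * pderiv a - a * pderiv b)) * ev [:-r, 1:]"
    unfolding ev_mult[symmetric] by (simp only: mult.assoc mult.commute mult.left_commute)
  also have "\<dots> = \<delta> g * ev (b\<^sup>2) * ev [:-r, 1:]"
    by (simp only: delta_K_ev[OF assms(1) g])
  also have "\<dots> = \<delta> g * ev [:-r, 1:] * ev (b\<^sup>2)"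
    by (simp only: mult.assoc ev_commute)
  also have "\<dots> = ev (h * b\<^sup>2)"
    by (simp only: assms(3) ev_mult)
  finally have "[:-r, 1:] * [:0, 1:] * (b * pderiv a - a * pderiv b) = h * b\<^sup>2"
    by (simp only: ev_inject)
  then show ?thesis
    by (rule wronskian_simple_pole[OF b nocommon, rotated]) (simp add: assms(2))
qed

text \<open>The equation says dg/dq = c/q, with residue c at 0. Here the factor q of \<delta>
  supplies the linear factor of the pole, so f = 1.\<close>

lemma delta_K_const:
  assumes "g \<in> K" and "\<delta> g = iota c"
  shows "c = 0"
proof -
  obtain a b where b: "b \<noteq> 0" and g: "g * ev b = ev a"
    and nocommon: "\<And>r. \<not> (poly a r = 0 \<and> poly b r = 0)"
    using K_reduced[OF assms(1)] by metis
  have "ev ([:-0, 1:] * 1 * (b * pderiv a - a * pderiv b)) = ev ([:c:] * b\<^sup>2)"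
    using delta_K_ev[OF assms(1) g] by (simp add: assms(2) ev_smult)
  then have "[:-0, 1:] * 1 * (b * pderiv a - a * pderiv b) = [:c:] * b\<^sup>2"
    by (simp only: ev_inject)
  then have "poly [:c:] 0 = 0"
    by (rule wronskian_simple_pole[OF b nocommon, rotated]) simp
  then show ?thesis by simp
qed

end

section \<open>Independence of words\<close>

text \<open>The condition on \<rho> rules out nonzero g in K with \<delta> g = 2\<rho> g or -2\<rho>
  g, which keeps the two inverses in \<open>G\<close> apart.\<close>

locale heis_pair = weyl_pair iota N q
  for iota :: "'k::field_char_0 \<Rightarrow> 'd::division_ring" and N q :: 'd +
  fixes \<rho> :: 'k
  assumes rho: "2 * \<rho> \<notin> \<int>"
begin

definition \<rho>s :: "bool \<Rightarrow> 'k" where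
  "\<rho>s t = (if t then \<rho> else - \<rho>)"

definition G :: "bool \<Rightarrow> 'd" where
  "G t = inverse (N - iota (\<rho>s t))"

definition u :: 'd where
  "u = (1 + q) * inverse (1 - q)"

definition \<mu> :: "bool \<Rightarrow> 'd" where
  "\<mu> c = (if c then u else 1)"

definition S :: 'd where
  "S = 2 + iota (2 * \<rho>) * (G True - G False)"

definition T :: 'd where
  "T = inverse u * S * u"

abbreviation wd :: "bool list \<Rightarrow> 'd" where
  "wd \<equiv> word_eval S T"

definition W :: "nat \<Rightarrow> bool list set" where
  "W n = {w. length w = n}"

definition I :: "nat \<Rightarrow> (bool \<times> bool \<times> bool list) set" where
  "I n = UNIV \<times> UNIV \<times> W n"

text \<open>These are the new terms created by putting a letter in front of \<open>w\<close>, as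
  \<open>word_eval_Not_Cons\<close> shows.\<close>

definition e :: "bool \<times> bool \<times> bool list \<Rightarrow> 'd" where
  "e = (\<lambda>(t, c, w). G t * \<mu> c * wd w)"

text \<open>Nilpotency under commutation with q is Grothendieck's description of differential
  operators; the least vanishing power is the order plus one.\<close>

definition adq :: "'d \<Rightarrow> 'd" where
  "adq m = q * m - m * q"

text \<open>
  \<open>M 0\<close> stands in for the differential operators \<open>K[N]\<close>: it contains \<open>1\<close>, is closed under left
  multiplication by \<open>K\<close> and \<open>N\<close>, and no nonzero element of it is mapped into \<open>K\<close> by \<open>N - c\<close>.
\<close>

fun M :: "nat \<Rightarrow> 'd set" where
  "M 0 = {m. \<exists>j. (adq ^^ j) m = 0}"
| "M (Suc n) = {m + (\<Sum>i\<in>I n. \<gamma> i * e i) | m \<gamma>. m \<in> M n \<and> (\<forall>i. \<gamma> i \<in> K)}"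

declare M.simps(2) [simp del]

lemma rho_nonzero [simp]: "\<rho> \<noteq> 0"
  using rho by auto

lemma N_minus_iota_nonzero: "N - iota c \<noteq> 0"
proof
  assume "N - iota c = 0"
  then have "N = iota c" by simp
  then have "q = 0"
    using Nq by (simp add: iota_commute)
  then show False
    using q_nonzero by simp
qed

lemma ev_linear: "ev [:a, b:] = iota a + iota b * q"
  by (simp add: iota_commute)

lemma one_minus_q_nonzero: "1 - q \<noteq> 0" and one_plus_q_nonzero: "1 + q \<noteq> 0"
proof -
  show "1 - q \<noteq> 0"
  proof
    assume "1 - q = 0"
    then have "q = 1" by simp
    with Nq show False by simp
  qed
  show "1 + q \<noteq> 0"
  proof
    assume "1 + q = 0"
    then have "q = - 1" by (simp add: eq_neg_iff_add_eq_0 add.commute)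
    with Nq show False by simp
  qed
qed

lemma u_K [simp]: "u \<in> K"
  unfolding u_def by (intro K_mult K_add K_inverse K_diff K_1 K_q)

lemma u_nonzero [simp]: "u \<noteq> 0"
  unfolding u_def
  by (intro no_zero_divisors nonzero_imp_inverse_nonzero one_minus_q_nonzero one_plus_q_nonzero)

lemma mu_K [simp]: "\<mu> c \<in> K"
  by (simp add: \<mu>_def)

lemma mu_nonzero [simp]: "\<mu> c \<noteq> 0"
  by (simp add: \<mu>_def)

lemma finite_W [simp]: "finite (W n)"
  unfolding W_def using finite_lists_length_eq[of "UNIV :: bool set" n] by simp

lemma finite_I [simp]: "finite (I n)"
  by (simp add: I_def)

lemma W_Suc: "W (Suc n) = (\<lambda>(c, w). (\<not> c) # w) ` (UNIV \<times> W n)"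
proof (intro equalityI subsetI)
  fix v assume "v \<in> W (Suc n)"
  then obtain b w where "v = b # w" "length w = n"
    by (auto simp: W_def length_Suc_conv)
  then show "v \<in> (\<lambda>(c, w). (\<not> c) # w) ` (UNIV \<times> W n)"
    by (intro image_eqI[of _ _ "(\<not> b, w)"]) (auto simp: W_def)
qed (auto simp: W_def)

section \<open>Commutators with q and the order of an operator\<close>

lemma adq_add: "adq (a + b) = adq a + adq b"
  by (simp add: adq_def algebra_simps)

lemma adq_K_mult: "g \<in> K \<Longrightarrow> adq (g * m) = g * adq m"
  using K_commute[OF K_q, of g] by (simp add: adq_def right_diff_distrib flip: mult.assoc)

lemma adq_pow_add: "(adq ^^ j) (a + b) = (adq ^^ j) a + (adq ^^ j) b"
  by (induction j) (simp_all add: adq_add)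

lemma adq_pow_K_mult: "g \<in> K \<Longrightarrow> (adq ^^ j) (g * m) = g * (adq ^^ j) m"
  by (induction j) (simp_all add: adq_K_mult)

lemma adq_0 [simp]: "adq 0 = 0"
  by (simp add: adq_def)

lemma adq_pow_0 [simp]: "(adq ^^ j) 0 = 0"
  by (induction j) simp_all

lemma adq_pow_mono: "(adq ^^ i) m = 0 \<Longrightarrow> i \<le> j \<Longrightarrow> (adq ^^ j) m = 0"
  by (metis adq_pow_0 comp_apply funpow_add le_add_diff_inverse2)

lemma adq_N: "adq (N * m) = N * adq m - q * m"
proof -
  have "q * N = N * q - q"
    using Nq by (simp add: algebra_simps)
  then have "q * (N * m) = N * (q * m) - q * m"
    by (metis left_diff_distrib mult.assoc)
  then show ?thesis
    by (simp add: adq_def algebra_simps)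
qed

lemma adq_diff: "adq (a - b) = adq a - adq b"
  by (simp add: adq_def algebra_simps)

lemma adq_pow_diff: "(adq ^^ j) (a - b) = (adq ^^ j) a - (adq ^^ j) b"
  by (induction j) (simp_all add: adq_diff)

lemma of_nat_K [simp]: "of_nat n \<in> K"
  using K_iota[of "of_nat n"] by (simp add: iota_of_nat)

text \<open>Leibniz rule: [q, N] = -q commutes with q, so at most one of the j + 1 commutators can
  fall on N.\<close>

lemma adq_pow_N: "(adq ^^ Suc j) (N * m) = N * (adq ^^ Suc j) m - of_nat (Suc j) * q * (adq ^^ j) m"
proof (induction j)
  case 0
  then show ?case by (simp add: adq_N)
next
  case (Suc j)
  have "of_nat (Suc j) * q \<in> K"
    by (intro K_mult of_nat_K K_q)
  then have "(adq ^^ Suc (Suc j)) (N * m) =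
      N * (adq ^^ Suc (Suc j)) m - q * (adq ^^ Suc j) m - of_nat (Suc j) * q * (adq ^^ Suc j) m"
    using Suc.IH by (simp add: adq_diff adq_N adq_K_mult del: of_nat_Suc)
  then show ?case
    by (simp add: algebra_simps)
qed

lemma of_nat_Suc_nonzero: "(of_nat (Suc j) :: 'd) \<noteq> 0"
  by (metis iota_eq_0_iff iota_of_nat of_nat_neq_0)

text \<open>N raises the order by one. If j > 0 is the least power killing m, then
  \<open>adq ^^ j\<close> sends (N - c) m to a nonzero multiple of
  \<open>(adq ^^ (j - 1)) m\<close>, yet it kills K.\<close>

lemma M0_N_in_K:
  assumes "m \<in> M 0" and "(N - iota c) * m \<in> K"
  shows "m = 0"
proof -
  define j where "j = (LEAST j. (adq ^^ j) m = 0)"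
  have j: "(adq ^^ j) m = 0"
    using assms(1) unfolding j_def by (auto intro: LeastI)
  have jmin: "(adq ^^ i) m \<noteq> 0" if "i < j" for i
    using that not_less_Least unfolding j_def by blast
  show ?thesis
  proof (cases j)
    case 0
    then show ?thesis using j by simp
  next
    case (Suc i)
    have "adq ((N - iota c) * m) = 0"
      by (simp only: adq_def K_commute[OF assms(2) K_q] diff_self)
    then have "(adq ^^ Suc i) ((N - iota c) * m) = 0"
      by (simp only: funpow_Suc_right o_apply adq_pow_0)
    moreover have "(adq ^^ Suc i) ((N - iota c) * m) = - (of_nat (Suc i) * q * (adq ^^ i) m)"
      using j unfolding Suc left_diff_distrib adq_pow_diff adq_pow_N adq_pow_K_mult[OF K_iota]
      by simp
    ultimately have "(adq ^^ i) m = 0"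
      using of_nat_Suc_nonzero[of i] q_nonzero by (simp del: of_nat_Suc)
    then show ?thesis
      using jmin[of i] Suc by simp
  qed
qed

section \<open>The filtration \<open>M\<close> and the words inside it\<close>

lemma M_0_in [simp]: "0 \<in> M n"
proof (induction n)
  case (Suc n)
  then show ?case
    unfolding M.simps mem_Collect_eq by (intro exI[of _ 0] exI[of _ "\<lambda>_. 0"]) simp
qed simp

lemma M_SucI: "m \<in> M n \<Longrightarrow> (\<And>i. \<gamma> i \<in> K) \<Longrightarrow> m + (\<Sum>i\<in>I n. \<gamma> i * e i) \<in> M (Suc n)"
  by (auto simp: M.simps(2))

lemma M_SucE:
  assumes "m \<in> M (Suc n)"
  obtains m' \<gamma> where "m' \<in> M n" "\<And>i. \<gamma> i \<in> K" "m = m' + (\<Sum>i\<in>I n. \<gamma> i * e i)"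
  using assms by (auto simp: M.simps(2))

lemma M_add [intro]: "a \<in> M n \<Longrightarrow> b \<in> M n \<Longrightarrow> a + b \<in> M n"
proof (induction n arbitrary: a b)
  case 0
  then obtain i j where "(adq ^^ i) a = 0" "(adq ^^ j) b = 0" by auto
  then have "(adq ^^ (max i j)) a = 0" "(adq ^^ (max i j)) b = 0"
    by (auto intro: adq_pow_mono)
  then have "(adq ^^ (max i j)) (a + b) = 0"
    by (simp add: adq_pow_add)
  then show ?case unfolding M.simps by blast
next
  case (Suc n)
  obtain m \<gamma> where a: "m \<in> M n" "\<And>i. \<gamma> i \<in> K" "a = m + (\<Sum>i\<in>I n. \<gamma> i * e i)"
    using Suc.prems(1) by (blast elim: M_SucE)
  obtain m' \<gamma>' where b: "m' \<in> M n" "\<And>i. \<gamma>' i \<in> K" "b = m' + (\<Sum>i\<in>I n. \<gamma>' i * e i)"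
    using Suc.prems(2) by (blast elim: M_SucE)
  have "a + b = (m + m') + (\<Sum>i\<in>I n. (\<gamma> i + \<gamma>' i) * e i)"
    by (simp add: a b distrib_right sum.distrib)
  moreover have "\<dots> \<in> M (Suc n)"
    by (intro M_SucI Suc.IH a b K_add)
  ultimately show ?case by simp
qed

lemma M_K_mult [intro]: "g \<in> K \<Longrightarrow> a \<in> M n \<Longrightarrow> g * a \<in> M n"
proof (induction n arbitrary: a)
  case 0
  then show ?case
    by (auto simp: adq_pow_K_mult)
next
  case (Suc n)
  obtain m \<gamma> where a: "m \<in> M n" "\<And>i. \<gamma> i \<in> K" "a = m + (\<Sum>i\<in>I n. \<gamma> i * e i)"
    using Suc.prems(2) by (blast elim: M_SucE)
  have "g * a = g * m + (\<Sum>i\<in>I n. (g * \<gamma> i) * e i)"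
    by (simp add: a distrib_left sum_distrib_left mult.assoc)
  moreover have "\<dots> \<in> M (Suc n)"
    by (intro M_SucI Suc.IH Suc.prems(1) a K_mult)
  ultimately show ?case by simp
qed

lemma M_minus [intro]: "a \<in> M n \<Longrightarrow> - a \<in> M n"
  using M_K_mult[OF K_iota[of "- 1"], of a n] by (simp add: iota_minus)

lemma M_diff [intro]: "a \<in> M n \<Longrightarrow> b \<in> M n \<Longrightarrow> a - b \<in> M n"
  using M_add[OF _ M_minus, of a n b] by simp

lemma M_sum [intro]: "(\<And>i. i \<in> A \<Longrightarrow> f i \<in> M n) \<Longrightarrow> sum f A \<in> M n"
  by (induction A rule: infinite_finite_induct) auto

lemma M_Suc: "a \<in> M n \<Longrightarrow> a \<in> M (Suc n)"
  using M_SucI[of a n "\<lambda>_. 0"] by simp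

lemma M_mono: "a \<in> M m \<Longrightarrow> m \<le> n \<Longrightarrow> a \<in> M n"
  by (rule dec_induct[where P = "\<lambda>n. a \<in> M n"]) (auto intro: M_Suc simp del: M.simps)

lemma e_in_M:
  assumes "i \<in> I n"
  shows "e i \<in> M (Suc n)"
proof -
  have "(\<Sum>j\<in>I n. (if j = i then 1 else 0) * e j) = e i"
    using assms by (simp add: if_distrib[of "\<lambda>x. x * _"] cong: if_cong)
  then show ?thesis
    using M_SucI[OF M_0_in, of "\<lambda>j. if j = i then 1 else 0" n] by simp
qed

text \<open>Conjugation by u leaves the summand 2 of S unchanged, so both letters have one shape: 2
  plus a multiple of the conjugate of G True - G False by \<open>\<mu> c\<close>.\<close>

lemma word_eval_Not_Cons:
  "wd ((\<not> c) # w) = iota 2 * wd w +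
    (iota (2 * \<rho>) * inverse (\<mu> c)) * (e (True, c, w) - e (False, c, w))"
proof (cases c)
  case False
  then show ?thesis
    by (simp add: word_eval_Cons S_def e_def \<mu>_def left_diff_distrib right_diff_distrib
        distrib_right mult.assoc iota_numeral)
next
  case True
  have "T = inverse u * (iota 2 * u) + inverse u * (iota (2 * \<rho>) * ((G True - G False) * u))"
    unfolding T_def S_def iota_numeral by (simp only: distrib_left distrib_right mult.assoc)
  also have "\<dots> = iota 2 + iota (2 * \<rho>) * (inverse u * ((G True - G False) * u))"
    unfolding iota_left_commute[of "inverse u"] by simp
  finally have "wd (False # w) =
      iota 2 * wd w + iota (2 * \<rho>) * (inverse u * ((G True - G False) * u)) * wd w"
    by (simp add: word_eval_Cons distrib_right)
  then show ?thesis
    using True by (simp add: e_def \<mu>_def left_diff_distrib right_diff_distrib mult.assoc)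
qed

lemma wd_in_M: "wd w \<in> M (length w)"
proof (induction w)
  case Nil
  have "(adq ^^ 1) 1 = 0"
    by (simp add: adq_def)
  then show ?case
    by (auto intro!: exI[of _ 1])
next
  case (Cons b w)
  have "(t, c, w) \<in> I (length w)" for t c
    by (simp add: I_def W_def)
  then have "wd ((\<not> \<not> b) # w) \<in> M (Suc (length w))"
    unfolding word_eval_Not_Cons
    by (intro M_add M_K_mult M_diff e_in_M K_mult K_iota K_inverse mu_K M_Suc[OF Cons.IH])
  then show ?case by simp
qed

text \<open>
  The coefficients obtained from \<open>\<Sum>i. \<gamma> i * e i\<close> by left multiplication with \<open>N - \<rho>s s\<close>; the
  remaining terms \<open>descent\<close> lie in \<open>M n\<close> for \<open>i \<in> I n\<close>.
\<close>

definition twisted :: "bool \<Rightarrow> (bool \<times> bool \<times> bool list \<Rightarrow> 'd) \<Rightarrow> bool \<times> bool \<times> bool list \<Rightarrow> 'd" where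
  "twisted s \<gamma> = (\<lambda>(t, c, w). \<delta> (\<gamma> (t, c, w)) + iota (\<rho>s t - \<rho>s s) * \<gamma> (t, c, w))"

definition descent :: "(bool \<times> bool \<times> bool list \<Rightarrow> 'd) \<Rightarrow> bool \<times> bool \<times> bool list \<Rightarrow> 'd" where
  "descent \<gamma> = (\<lambda>(t, c, w). \<gamma> (t, c, w) * \<mu> c * wd w)"

lemma twisted_K: "(\<And>i. \<gamma> i \<in> K) \<Longrightarrow> twisted s \<gamma> i \<in> K"
  by (cases i) (auto simp: twisted_def intro!: K_add K_delta K_mult)

text \<open>Moving N past the coefficient produces \<delta>, and N G = 1 + \<rho> G (with the sign
  of \<open>t\<close>) reproduces the element \<open>e i\<close>; the 1 strips off G and leaves
  \<open>descent\<close>.\<close>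

lemma N_mult_e: "(N - iota (\<rho>s s)) * (\<gamma> i * e i) = twisted s \<gamma> i * e i + descent \<gamma> i"
proof -
  obtain t c w where i: "i = (t, c, w)" by (cases i)
  have NG: "N * G t = 1 + iota (\<rho>s t) * G t"
  proof -
    have "(N - iota (\<rho>s t)) * G t = 1"
      unfolding G_def using N_minus_iota_nonzero by simp
    then show ?thesis by (simp add: algebra_simps)
  qed
  have "N * (\<gamma> i * e i) = \<delta> (\<gamma> i) * e i + \<gamma> i * (N * G t) * \<mu> c * wd w"
    by (simp add: \<delta>_def i e_def algebra_simps)
  also have "\<dots> = \<delta> (\<gamma> i) * e i + \<gamma> i * \<mu> c * wd w + iota (\<rho>s t) * (\<gamma> i * e i)"
    by (simp add: NG i e_def distrib_left distrib_right mult.assoc iota_left_commute)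
  finally show ?thesis
    by (simp add: i twisted_def descent_def iota_diff algebra_simps)
qed

lemma N_mult_sum:
  "(N - iota (\<rho>s s)) * (\<Sum>i\<in>A. \<gamma> i * e i) = (\<Sum>i\<in>A. twisted s \<gamma> i * e i) + (\<Sum>i\<in>A. descent \<gamma> i)"
  by (simp add: sum_distrib_left N_mult_e sum.distrib)

lemma descent_in_M: "i \<in> I n \<Longrightarrow> (\<And>i. \<gamma> i \<in> K) \<Longrightarrow> descent \<gamma> i \<in> M n"
  using wd_in_M by (auto simp: descent_def I_def W_def intro!: M_K_mult K_mult)

lemma N_mult_in_M: "m \<in> M n \<Longrightarrow> (N - iota (\<rho>s s)) * m \<in> M n"
proof (induction n arbitrary: m)
  case 0
  then obtain j where j: "(adq ^^ j) m = 0" by auto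
  then have "(adq ^^ Suc j) m = 0" by simp
  with j have "(adq ^^ Suc j) ((N - iota (\<rho>s s)) * m) = 0"
    unfolding left_diff_distrib adq_pow_diff adq_pow_N adq_pow_K_mult[OF K_iota] by simp
  then show ?case unfolding M.simps by blast
next
  case (Suc n)
  obtain m' \<gamma> where m: "m' \<in> M n" "\<And>i. \<gamma> i \<in> K" "m = m' + (\<Sum>i\<in>I n. \<gamma> i * e i)"
    using Suc.prems by (blast elim: M_SucE)
  have "(N - iota (\<rho>s s)) * m =
      ((N - iota (\<rho>s s)) * m' + (\<Sum>i\<in>I n. descent \<gamma> i)) + (\<Sum>i\<in>I n. twisted s \<gamma> i * e i)"
    unfolding m(3) distrib_left N_mult_sum by (simp only: add_ac)
  moreover have "(N - iota (\<rho>s s)) * m' + (\<Sum>i\<in>I n. descent \<gamma> i) \<in> M n"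
    using m Suc.IH descent_in_M by blast
  ultimately show ?case
    using M_SucI[of _ n "twisted s \<gamma>"] twisted_K[of \<gamma>, OF m(2)] by metis
qed

text \<open>
  The leading part of \<open>\<Sum>v. co v * wd v\<close> over words of length \<open>n + 1\<close>, expanded in the elements
  \<open>e i\<close> with \<open>i \<in> I n\<close>. The flag \<open>c\<close> of an index says whether \<open>u\<close> occurs, so it is the negation of
  the letter, \<open>S\<close> being \<open>True\<close>.
\<close>

definition lift_coeff :: "(bool list \<Rightarrow> 'd) \<Rightarrow> bool \<times> bool \<times> bool list \<Rightarrow> 'd" where
  "lift_coeff co = (\<lambda>(t, c, w). co ((\<not> c) # w) * (iota (2 * \<rho>s t) * inverse (\<mu> c)))"

lemma lift_coeff_K: "(\<And>v. co v \<in> K) \<Longrightarrow> lift_coeff co i \<in> K"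
  by (cases i) (auto simp: lift_coeff_def intro!: K_mult)

lemma sum_I: "(\<Sum>i\<in>I n. f i) = (\<Sum>(c, w)\<in>UNIV \<times> W n. f (True, c, w) + f (False, c, w))"
  unfolding I_def sum.cartesian_product' by (simp add: UNIV_bool add_ac sum.distrib)

text \<open>The summand 2 of each leading letter only contributes words of length n, which lie in
  \<open>M n\<close>.\<close>

lemma sum_words:
  assumes "\<And>v. co v \<in> K"
  shows "(\<Sum>v\<in>W (Suc n). co v * wd v) - (\<Sum>i\<in>I n. lift_coeff co i * e i) \<in> M n"
proof -
  have inj: "inj_on (\<lambda>(c, w). (\<not> c) # w) (UNIV \<times> W n)"
    by (auto simp: inj_on_def)
  have "(\<Sum>v\<in>W (Suc n). co v * wd v) = (\<Sum>(c, w)\<in>UNIV \<times> W n. co ((\<not> c) # w) * wd ((\<not> c) # w))"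
    unfolding W_Suc sum.reindex[OF inj] by (simp add: case_prod_beta')
  also have "\<dots> = (\<Sum>(c, w)\<in>UNIV \<times> W n. co ((\<not> c) # w) * (iota 2 * wd w)) +
      (\<Sum>(c, w)\<in>UNIV \<times> W n. lift_coeff co (True, c, w) * e (True, c, w) + lift_coeff co (False, c, w) * e (False, c, w))"
    unfolding sum.distrib[symmetric] word_eval_Not_Cons
    by (intro sum.cong) (auto simp: lift_coeff_def \<rho>s_def algebra_simps iota_minus)
  also have "\<dots> = (\<Sum>(c, w)\<in>UNIV \<times> W n. co ((\<not> c) # w) * (iota 2 * wd w)) + (\<Sum>i\<in>I n. lift_coeff co i * e i)"
    by (simp only: sum_I)
  finally show ?thesis
    using assms wd_in_M by (auto simp: W_def intro!: M_sum M_K_mult)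
qed

section \<open>Residues and linear independence\<close>

lemma delta_K_eq_u:
  assumes g: "g \<in> K" and r: "r \<noteq> 0"
    and eq: "\<delta> g = (iota a + iota b * u) * (iota r * inverse (\<mu> c))"
  shows "a = 0 \<and> b = 0"
proof (cases c)
  case False
  have u: "u * (q - 1) = - (1 + q)"
  proof -
    have "u * (1 - q) = 1 + q"
      using one_minus_q_nonzero by (simp add: u_def mult.assoc)
    then show ?thesis
      by (metis minus_diff_eq mult_minus_right)
  qed
  have "\<delta> g = (iota a + iota b * u) * iota r"
    using False by (simp add: eq \<mu>_def)
  also have "\<dots> = iota r * (iota a + iota b * u)"
    by (rule iota_commute[symmetric])
  finally have "\<delta> g * ev [:-1, 1:] = iota r * (iota a * (q - 1) + iota b * (u * (q - 1)))"
    by (simp add: iota_minus distrib_right mult.assoc)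
  also have "\<dots> = ev [:- (r * (a + b)), r * (a - b):]"
    unfolding u ev_linear
    by (simp add: iota_mult iota_add iota_diff iota_minus distrib_left distrib_right
        left_diff_distrib right_diff_distrib mult.assoc)
  \<comment> \<open>The pole of u at q = 1 is tested: the value there is -2rb. Once b = 0, the
    remaining constant is excluded by the pole at 0.\<close>
  finally have "poly [:- (r * (a + b)), r * (a - b):] 1 = 0"
    by (intro delta_K_simple_pole[OF g]) simp_all
  then have b: "b = 0"
    using r by (simp add: algebra_simps)
  then have "\<delta> g = iota (a * r)"
    using False eq by (simp add: \<mu>_def iota_mult)
  then show ?thesis
    using delta_K_const[OF g, of "a * r"] r b by simp
next
  case True
  have u: "inverse u * (q + 1) = 1 - q"
    using one_minus_q_nonzero one_plus_q_nonzero
    by (simp add: u_def nonzero_inverse_mult_distrib mult.assoc add.commute)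
  have "\<delta> g = iota r * ((iota a + iota b * u) * inverse u)"
    using True unfolding eq \<mu>_def iota_left_commute[of _ r] by simp
  also have "\<dots> = iota r * (iota a * inverse u + iota b)"
    by (simp add: distrib_right mult.assoc)
  finally have eq': "\<delta> g = iota r * (iota a * inverse u + iota b)" .
  have "\<delta> g * ev [:- (- 1), 1:] = iota r * (iota a * (inverse u * (q + 1)) + iota b * (q + 1))"
    by (simp add: eq' distrib_right distrib_left mult.assoc add.commute)
  also have "\<dots> = ev [:r * (a + b), r * (b - a):]"
    unfolding u ev_linear
    by (simp add: iota_mult iota_add iota_diff iota_minus distrib_left distrib_right
        left_diff_distrib right_diff_distrib mult.assoc)
  \<comment> \<open>After division by u the pole sits at q = -1, where the value is 2ra, so a and b
    exchange roles.\<close>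
  finally have "poly [:r * (a + b), r * (b - a):] (- 1) = 0"
    by (intro delta_K_simple_pole[OF g]) simp_all
  then have a: "a = 0"
    using r by (simp add: algebra_simps)
  then have "\<delta> g = iota (r * b)"
    by (simp add: eq' iota_mult)
  then show ?thesis
    using delta_K_const[OF g, of "r * b"] r a by simp
qed

lemma rhos_diff: "t \<noteq> s \<Longrightarrow> - (\<rho>s t - \<rho>s s) \<notin> \<int>"
  using rho Ints_minus[of "- (2 * \<rho>)"] by (cases t; cases s) (auto simp: \<rho>s_def)

text \<open>
  A relation of minimal support, normalised to have a coefficient \<open>1\<close>, is annihilated by \<open>twisted s\<close>,
  which would otherwise produce a relation of smaller support.
\<close>

lemma relation_normal_form:
  assumes K: "\<And>i. \<gamma> i \<in> K" and rel: "(\<Sum>i\<in>I n. \<gamma> i * e i) \<in> M n"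
    and nz: "\<exists>i\<in>I n. \<gamma> i \<noteq> 0"
  obtains \<gamma>1 s c w where "\<And>i. \<gamma>1 i \<in> K" and "(\<Sum>i\<in>I n. \<gamma>1 i * e i) \<in> M n"
    and "w \<in> W n" and "\<gamma>1 (s, c, w) = 1" and "\<And>i. i \<in> I n \<Longrightarrow> twisted s \<gamma>1 i = 0"
proof -
  define Rel where "Rel = (\<lambda>\<gamma>. (\<forall>i. \<gamma> i \<in> K) \<and> (\<Sum>i\<in>I n. \<gamma> i * e i) \<in> M n \<and> (\<exists>i\<in>I n. \<gamma> i \<noteq> 0))"
  define supp where "supp = (\<lambda>\<gamma> :: _ \<Rightarrow> 'd. {i \<in> I n. \<gamma> i \<noteq> 0})"
  have "Rel \<gamma>"
    using assms by (auto simp: Rel_def)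
  then obtain \<gamma>0 where rel0: "Rel \<gamma>0" and min: "\<And>\<gamma>'. Rel \<gamma>' \<Longrightarrow> card (supp \<gamma>0) \<le> card (supp \<gamma>')"
    using arg_min_natI[of Rel \<gamma> "\<lambda>\<gamma>. card (supp \<gamma>)"] arg_min_nat_le[of Rel _ "\<lambda>\<gamma>. card (supp \<gamma>)"]
    by blast
  then obtain s c w where i0: "(s, c, w) \<in> I n" "\<gamma>0 (s, c, w) \<noteq> 0"
    unfolding Rel_def by (metis prod_cases3)
  define g where "g = inverse (\<gamma>0 (s, c, w))"
  have g: "g \<in> K" "g \<noteq> 0"
    using rel0 i0 by (auto simp: Rel_def g_def)
  define \<gamma>1 where "\<gamma>1 = (\<lambda>i. g * \<gamma>0 i)"
  have K1: "\<gamma>1 i \<in> K" for i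
    using rel0 g unfolding \<gamma>1_def Rel_def by blast
  have "(\<Sum>i\<in>I n. \<gamma>1 i * e i) = g * (\<Sum>i\<in>I n. \<gamma>0 i * e i)"
    by (simp add: \<gamma>1_def sum_distrib_left mult.assoc)
  then have M1: "(\<Sum>i\<in>I n. \<gamma>1 i * e i) \<in> M n"
    using rel0 g by (auto simp: Rel_def)
  have one: "\<gamma>1 (s, c, w) = 1"
    using i0 by (simp add: \<gamma>1_def g_def)
  have "(\<Sum>i\<in>I n. twisted s \<gamma>1 i * e i) =
      (N - iota (\<rho>s s)) * (\<Sum>i\<in>I n. \<gamma>1 i * e i) - (\<Sum>i\<in>I n. descent \<gamma>1 i)"
    by (simp add: N_mult_sum)
  also have "\<dots> \<in> M n"
    by (intro M_diff[OF N_mult_in_M[OF M1] M_sum] descent_in_M K1)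
  finally have M2: "(\<Sum>i\<in>I n. twisted s \<gamma>1 i * e i) \<in> M n" .
  have "twisted s \<gamma>1 i = 0" if "\<gamma>0 i = 0" for i
    using that by (cases i) (simp add: twisted_def \<gamma>1_def)
  \<comment> \<open>Both \<delta> 1 and the scalar at sign \<open>s\<close> vanish, so this index
    leaves the support, while no new index enters.\<close>
  moreover have "twisted s \<gamma>1 (s, c, w) = 0"
    using one by (simp add: twisted_def)
  ultimately have "supp (twisted s \<gamma>1) \<subset> supp \<gamma>0"
    using i0 by (auto simp: supp_def)
  then have "card (supp (twisted s \<gamma>1)) < card (supp \<gamma>0)"
    by (intro psubset_card_mono) (simp_all add: supp_def)
  then have "\<not> Rel (twisted s \<gamma>1)"
    using min by (meson not_le)
  then have "twisted s \<gamma>1 i = 0" if "i \<in> I n" for i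
    using that M2 twisted_K[OF K1] by (auto simp: Rel_def)
  moreover have "w \<in> W n"
    using i0 by (simp add: I_def)
  ultimately show ?thesis
    using that K1 M1 one by blast
qed

text \<open>Independence over K modulo \<open>M n\<close>. A normalised relation, multiplied by N
  minus its scalar, becomes a combination of words of length n with coefficients a + b u. Being N
  minus a scalar applied to an element of \<open>M n\<close>, it must be trivial: by the order
  argument for n = 0, by residues otherwise.\<close>

lemma e_independent:
  assumes "\<And>i. \<gamma> i \<in> K" and "(\<Sum>i\<in>I n. \<gamma> i * e i) \<in> M n" and "i \<in> I n"
  shows "\<gamma> i = 0"
  using assms
proof (induction n arbitrary: \<gamma> i)
  \<comment> \<open>Shared by base case and induction step, which differ only in how the last
    assumption is established.\<close>
  have step: False
    if K: "\<And>i. \<gamma> i \<in> K" and rel: "(\<Sum>i\<in>I n. \<gamma> i * e i) \<in> M n" and i: "i \<in> I n" "\<gamma> i \<noteq> 0"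
      and IH: "\<And>m s co. (\<And>v. co v \<in> K) \<Longrightarrow> m \<in> M n \<Longrightarrow>
        (N - iota (\<rho>s s)) * m = (\<Sum>v\<in>W n. co v * wd v) \<Longrightarrow>
        (\<And>v. v \<in> W n \<Longrightarrow> \<exists>a b. co v = iota a + iota b * u) \<Longrightarrow> (\<forall>v\<in>W n. co v = 0)"
    for \<gamma> n i
  proof -
    have nz: "\<exists>i\<in>I n. \<gamma> i \<noteq> 0"
      using i by blast
    obtain \<gamma>1 s c w where K1: "\<And>i. \<gamma>1 i \<in> K" and M1: "(\<Sum>i\<in>I n. \<gamma>1 i * e i) \<in> M n"
      and w: "w \<in> W n" and one: "\<gamma>1 (s, c, w) = 1"
      and twisted0: "\<And>i. i \<in> I n \<Longrightarrow> twisted s \<gamma>1 i = 0"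
      by (rule relation_normal_form[OF K rel nz]) blast
    have I_iff: "(t, c, v) \<in> I n \<longleftrightarrow> v \<in> W n" for t c v
      by (simp add: I_def)
    \<comment> \<open>For the opposite sign, vanishing of \<open>twisted\<close> is an eigenvector
      equation of \<delta> with a non-integral eigenvalue; for the sign \<open>s\<close> it says
      that the coefficient is constant.\<close>
    have other: "\<gamma>1 (\<not> s, c, v) = 0" if "v \<in> W n" for c v
    proof (rule delta_K_eigen[OF K1 rhos_diff])
      show "\<delta> (\<gamma>1 (\<not> s, c, v)) = iota (- (\<rho>s (\<not> s) - \<rho>s s)) * \<gamma>1 (\<not> s, c, v)"
        using twisted0[of "(\<not> s, c, v)"] that
        by (simp add: I_iff twisted_def iota_minus eq_neg_iff_add_eq_0 del: minus_diff_eq)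
    qed simp
    have const: "\<exists>a. \<gamma>1 (s, c, v) = iota a" if "v \<in> W n" for c v
    proof -
      have "\<delta> (\<gamma>1 (s, c, v)) = 0"
        using twisted0[of "(s, c, v)"] that by (simp add: I_iff twisted_def)
      then show ?thesis
        by (rule delta_K_eq_0[OF K1]) blast
    qed
    \<comment> \<open>With G stripped off, the indices with flags \<open>False\<close> and
      \<open>True\<close> end in the same word and merge.\<close>
    define co where "co = (\<lambda>v. \<gamma>1 (s, False, v) + \<gamma>1 (s, True, v) * u)"
    have co_K: "co v \<in> K" for v
      unfolding co_def by (intro K_add K_mult K1 u_K)
    have "(N - iota (\<rho>s s)) * (\<Sum>i\<in>I n. \<gamma>1 i * e i) = (\<Sum>i\<in>I n. descent \<gamma>1 i)"
      by (simp add: N_mult_sum twisted0)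
    also have "\<dots> = (\<Sum>(c, v)\<in>UNIV \<times> W n. descent \<gamma>1 (s, c, v))"
      unfolding sum_I using other by (intro sum.cong) (cases s; auto simp: descent_def)+
    also have "\<dots> = (\<Sum>v\<in>W n. co v * wd v)"
      unfolding sum.cartesian_product[symmetric]
      by (simp add: UNIV_bool descent_def co_def \<mu>_def distrib_right sum.distrib add.commute)
    finally have eq: "(N - iota (\<rho>s s)) * (\<Sum>i\<in>I n. \<gamma>1 i * e i) = (\<Sum>v\<in>W n. co v * wd v)" .
    have "\<forall>v\<in>W n. co v = 0"
    proof (rule IH[OF co_K M1 eq])
      fix v assume "v \<in> W n"
      then obtain a b where "\<gamma>1 (s, False, v) = iota a" "\<gamma>1 (s, True, v) = iota b"
        using const by meson
      then show "\<exists>a b. co v = iota a + iota b * u"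
        by (auto simp: co_def)
    qed
    then have co0: "co w = 0"
      using w by blast
    obtain a b where ab: "\<gamma>1 (s, False, w) = iota a" "\<gamma>1 (s, True, w) = iota b"
      using const w by metis
    \<comment> \<open>Taking g = 0 and r = 1 in \<open>delta_K_eq_u\<close> gives the linear
      independence of 1 and u over k.\<close>
    have "\<delta> 0 = (iota a + iota b * u) * (iota 1 * inverse (\<mu> False))"
      using co0 by (simp add: co_def ab)
    then have "a = 0 \<and> b = 0"
      by (rule delta_K_eq_u[rotated 2]) simp_all
    then show False
      using ab one by (cases c) auto
  qed
  {
    case 0
    show ?case
    proof (rule ccontr)
      assume nz: "\<gamma> i \<noteq> 0"
      show False
      proof (rule step[OF 0 nz])
        fix m s and co :: "bool list \<Rightarrow> 'd"
        assume co: "\<And>v. co v \<in> K" and m: "m \<in> M 0"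
          and eq: "(N - iota (\<rho>s s)) * m = (\<Sum>v\<in>W 0. co v * wd v)"
        have W0: "W 0 = {[]}"
          by (auto simp: W_def)
        have "m = 0"
          by (rule M0_N_in_K[OF m, of "\<rho>s s"]) (simp add: eq W0 co)
        then show "\<forall>v\<in>W 0. co v = 0"
          using eq by (simp add: W0)
      qed
    qed
  next
    case (Suc n)
    show ?case
    proof (rule ccontr)
      assume nz: "\<gamma> i \<noteq> 0"
      show False
      proof (rule step[OF Suc.prems nz])
        fix m s and co :: "bool list \<Rightarrow> 'd"
        assume co: "\<And>v. co v \<in> K" and m: "m \<in> M (Suc n)"
          and eq: "(N - iota (\<rho>s s)) * m = (\<Sum>v\<in>W (Suc n). co v * wd v)"
          and ab: "\<And>v. v \<in> W (Suc n) \<Longrightarrow> \<exists>a b. co v = iota a + iota b * u"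
        obtain m' \<gamma>3 where m': "m' \<in> M n" "\<And>i. \<gamma>3 i \<in> K" "m = m' + (\<Sum>i\<in>I n. \<gamma>3 i * e i)"
          using m by (blast elim: M_SucE)
        \<comment> \<open>Both sides of \<open>eq\<close> are expanded in the elements
          \<open>e i\<close> modulo \<open>M n\<close>; the induction hypothesis then allows
          comparison of coefficients.\<close>
        have "(\<Sum>i\<in>I n. (lift_coeff co i - twisted s \<gamma>3 i) * e i) =
            (N - iota (\<rho>s s)) * m' + (\<Sum>i\<in>I n. descent \<gamma>3 i)
            - ((\<Sum>v\<in>W (Suc n). co v * wd v) - (\<Sum>i\<in>I n. lift_coeff co i * e i))"
          unfolding eq[symmetric] m'(3) distrib_left[of "N - iota (\<rho>s s)"] N_mult_sum
          by (simp add: left_diff_distrib sum_subtractf)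
        also have "\<dots> \<in> M n"
          by (intro M_diff[OF M_add[OF N_mult_in_M[OF m'(1)] M_sum] sum_words[OF co]] descent_in_M m'(2))
        finally have eq0: "lift_coeff co i - twisted s \<gamma>3 i = 0" if "i \<in> I n" for i
          using that lift_coeff_K[OF co] twisted_K[OF m'(2)] by (intro Suc.IH) auto
        show "\<forall>v\<in>W (Suc n). co v = 0"
        proof
          fix v assume v: "v \<in> W (Suc n)"
          then obtain c w where cw: "v = (\<not> c) # w" "w \<in> W n"
            by (auto simp: W_Suc)
          obtain a b where co_v: "co v = iota a + iota b * u"
            using ab[OF v] by blast
          \<comment> \<open>Only sign \<open>s\<close> is compared: there the scalar in
            \<open>twisted\<close> is zero and a pure \<delta> remains, as the residue argument
            requires.\<close>
          have "twisted s \<gamma>3 (s, c, w) = lift_coeff co (s, c, w)"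
            using eq0[of "(s, c, w)"] cw by (simp add: I_def)
          then have "\<delta> (\<gamma>3 (s, c, w)) = (iota a + iota b * u) * (iota (2 * \<rho>s s) * inverse (\<mu> c))"
            by (simp only: twisted_def lift_coeff_def prod.case cw(1)[symmetric] co_v) simp
          then have "a = 0 \<and> b = 0"
            by (rule delta_K_eq_u[OF m'(2), rotated]) (simp add: \<rho>s_def)
          then show "co v = 0"
            by (simp add: co_v)
        qed
      qed
    qed
  }
qed

text \<open>The words of maximal length k + 1 are isolated. The shorter ones lie in
  \<open>M k\<close>, so \<open>lift_coeff\<close> is a relation modulo \<open>M k\<close>; it
  vanishes, and it differs from the coefficients of \<open>p\<close> only by nonzero
  factors.\<close>

lemma words_independent:
  assumes "nc_fin p" and "nc_eval iota S T p = 0"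
  shows "p = nc_zero"
proof (rule ccontr)
  assume "p \<noteq> nc_zero"
  define A where "A = {w. p w \<noteq> 0}"
  have A: "finite A" "A \<noteq> {}"
    using assms(1) \<open>p \<noteq> nc_zero\<close> by (auto simp: A_def nc_fin_def nc_zero_def fun_eq_iff)
  define n where "n = Max (length ` A)"
  have le: "length w \<le> n" if "w \<in> A" for w
    using that A by (simp add: n_def)
  obtain v where v: "v \<in> A" "length v = n"
    using Max_in[of "length ` A"] A unfolding n_def by (metis finite_imageI image_iff image_is_empty)
  define L where "L = {w \<in> A. length w < n}"
  have disj: "L \<inter> W n = {}"
    by (auto simp: L_def W_def)
  have "finite L"
    using A by (simp add: L_def)
  moreover have "{w. p w \<noteq> 0} \<subseteq> L \<union> W n"
    using le by (fastforce simp: L_def W_def A_def)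
  ultimately have "(\<Sum>w\<in>L \<union> W n. iota (p w) * wd w) = 0"
    using assms(2) nc_eval_superset[of "L \<union> W n" p] by simp
  then have split: "(\<Sum>w\<in>W n. iota (p w) * wd w) = - (\<Sum>w\<in>L. iota (p w) * wd w)"
    using A by (subst (asm) sum.union_disjoint[OF _ _ disj])
      (simp_all add: L_def eq_neg_iff_add_eq_0 add.commute)
  show False
  proof (cases n)
    case 0
    then have "L = {}" "W n = {[]}" "v = []"
      using v by (auto simp: L_def W_def)
    then show False
      using split v by (simp add: A_def)
  next
    case (Suc k)
    define co where "co = (\<lambda>w. iota (p w))"
    have "(\<Sum>w\<in>L. iota (p w) * wd w) \<in> M k"
      by (intro M_sum M_K_mult K_iota M_mono[OF wd_in_M]) (auto simp: L_def Suc)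
    then have "- (\<Sum>w\<in>L. iota (p w) * wd w) -
        ((\<Sum>v\<in>W (Suc k). co v * wd v) - (\<Sum>i\<in>I k. lift_coeff co i * e i)) \<in> M k"
      by (intro M_diff[OF M_minus sum_words]) (simp_all add: co_def)
    then have "(\<Sum>i\<in>I k. lift_coeff co i * e i) \<in> M k"
      unfolding split[symmetric] Suc co_def by simp
    then have "lift_coeff co i = 0" if "i \<in> I k" for i
      using that by (intro e_independent[of "lift_coeff co"] lift_coeff_K) (simp_all add: co_def)
    moreover obtain c w where cw: "v = (\<not> c) # w" "w \<in> W k"
    proof -
      have "v \<in> W (Suc k)"
        using v Suc by (simp add: W_def)
      then show ?thesis
        using that by (auto simp: W_Suc)
    qed
    ultimately have "lift_coeff co (True, c, w) = 0"
      by (simp add: I_def)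
    then have "p v = 0"
      by (simp add: lift_coeff_def co_def cw \<rho>s_def)
    then show False
      using v by (simp add: A_def)
  qed
qed

end

section \<open>The Heisenberg algebra\<close>

text \<open>The involution fixes V and negates z^3, so it exchanges \<open>heis_Vm\<close> and
  \<open>heis_Vp\<close> and thereby the two summands of S. It sends z + y^2 to -(z - y^2) and vice
  versa; in T the signs cancel in pairs.\<close>

lemma principal_involution_fixes:
  fixes iota :: "'k::field_char_0 \<Rightarrow> 'd::division_ring"
  assumes ce: "central_embedding iota" and inv: "principal_involution iota x y star"
  shows "star (heis_S iota x y) = heis_S iota x y"
    and "star (heis_T iota x y) = heis_T iota x y"
proof -
  interpret central_embed iota
    by unfold_locales (rule ce)
  have add: "star (a + b) = star a + star b" and mult: "star (a * b) = star b * star a"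
    and lin: "star (iota c * a) = iota c * star a" and invol: "star (star a) = a" for a b c
    using inv unfolding principal_involution_def by blast+
  have xy: "star x = - x" "star y = - y"
    using inv unfolding principal_involution_def by blast+
  have star_1: "star 1 = 1"
    using mult[of 1 "star 1"] by (simp add: invol)
  have minus: "star (- a) = - star a" for a
    using lin[of "- 1" a] by (simp add: iota_minus)
  have diff: "star (a - b) = star a - star b" for a b
    using add[of a "- b"] by (simp add: minus)
  have star_0: "star 0 = 0"
    using diff[of 0 0] by simp
  have inverse: "star (inverse a) = inverse (star a)" for a
  proof (cases "a = 0")
    case False
    then have "star a * star (inverse a) = 1"
      by (simp flip: mult add: star_1)
    then show ?thesis
      by (rule inverse_unique[symmetric])
  qed (simp add: star_0)
  define z where "z = heis_z x y"
  have z: "star z = - z"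
    by (simp add: z_def heis_z_def diff mult xy)
  have V: "star (heis_V iota x y) = heis_V iota x y"
    unfolding heis_V_def z_def[symmetric]
    by (simp add: mult.assoc lin) (simp add: mult add xy z add.commute mult.assoc)
  have z3: "star (z ^ 3) = - (z ^ 3)"
    by (simp add: eval_nat_numeral mult z mult.assoc)
  have y2: "star (y ^ 2) = y ^ 2"
    by (simp add: power2_eq_square mult xy)
  have Vm: "star (heis_Vm iota x y) = heis_Vp iota x y"
    and Vp: "star (heis_Vp iota x y) = heis_Vm iota x y"
    by (simp_all add: heis_Vm_def heis_Vp_def z_def[symmetric] add diff lin V z3)
  show S: "star (heis_S iota x y) = heis_S iota x y"
    by (simp add: heis_S_def add mult inverse Vm Vp add.commute)
  have p: "star (z + y ^ 2) = - (z - y ^ 2)" and m: "star (z - y ^ 2) = - (z + y ^ 2)"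
    by (simp_all add: add diff z y2)
  show "star (heis_T iota x y) = heis_T iota x y"
    unfolding heis_T_def z_def[symmetric] mult inverse S p m
    by (simp only: inverse_minus_eq mult_minus_left mult_minus_right minus_minus mult.assoc)
qed

section \<open>Realising N and q in the division ring of the Heisenberg algebra\<close>

theorem mainTheorem6:
  fixes iota :: "'k::field_char_0 \<Rightarrow> 'd::division_ring" and x y :: 'd
  assumes "is_Ore_fractions_UH iota x y"
  shows "heis_Vm iota x y \<noteq> 0 \<and> heis_Vp iota x y \<noteq> 0 \<and>
         heis_z x y + y ^ 2 \<noteq> 0 \<and> heis_z x y - y ^ 2 \<noteq> 0 \<and>
         (\<forall>p. nc_fin p \<longrightarrow> nc_eval iota (heis_S iota x y) (heis_T iota x y) p = 0
                \<longrightarrow> p = nc_zero) \<and>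
         (\<forall>star. principal_involution iota x y star \<longrightarrow>
                star (heis_S iota x y) = heis_S iota x y \<and>
                star (heis_T iota x y) = heis_T iota x y)"
proof -
  have ce: "central_embedding iota"
    using assms by (simp add: is_Ore_fractions_UH_def)
  interpret central_embed iota
    by unfold_locales (rule ce)
  define z where "z = heis_z x y"
  have z0: "z \<noteq> 0" and zx: "z * x = x * z" and zy: "z * y = y * z"
    using heis_z_nonzero_central[OF assms] by (simp_all add: z_def)
  define zi where "zi = inverse z"
  have ziz: "zi * z = 1" "z * zi = 1"
    using z0 by (simp_all add: zi_def)
  have zix: "zi * x = x * zi" and ziy: "zi * y = y * zi"
    using inverse_commute[OF zx] inverse_commute[OF zy] by (simp_all add: zi_def)
  \<comment> \<open>Since z is central, V = z^2 (xy + yx) / 2, so this is -V z^-3 / 2. The factor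
    -1/4 comes from [xy + yx, y^2] = -4 y^2 z.\<close>
  define N where "N = iota (- 1 / 4) * ((x * y + y * x) * zi)"
  define q where "q = y\<^sup>2 * zi"
  have y0: "y \<noteq> 0"
    using z0 by (auto simp: z_def heis_z_def)
  have yx: "y * x = x * y + z"
    by (simp add: z_def heis_z_def)
  have q0: "q \<noteq> 0"
    using y0 z0 by (simp add: q_def zi_def)
  have Nq: "N * q - q * N = q"
  proof -
    \<comment> \<open>Rewriting to the normal order x, y, z, \<open>zi\<close>, inside right-nested
      products.\<close>
    have r: "y * (x * b) = x * (y * b) + z * b" "z * (x * b) = x * (z * b)" "z * (y * b) = y * (z * b)"
      "zi * (x * b) = x * (zi * b)" "zi * (y * b) = y * (zi * b)" "zi * (z * b) = b" "z * (zi * b) = b" for b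
      by (simp_all add: yx distrib_right zx zy zix ziy ziz flip: mult.assoc)
    have "(x * y + y * x) * zi * q - q * ((x * y + y * x) * zi) = - (q + q + q + q)"
      by (simp add: q_def power2_eq_square mult.assoc distrib_left distrib_right r yx zx zy zix ziy ziz)
    also have "\<dots> = iota (- (1 + 1 + 1 + 1)) * q"
      by (simp only: iota_minus iota_add iota_1 distrib_right mult_1_left mult_minus_left)
    finally have "N * q - q * N = iota (- 1 / 4) * (iota (- (1 + 1 + 1 + 1)) * q)"
      unfolding N_def iota_left_commute[of q] by (simp only: mult.assoc flip: right_diff_distrib)
    then show ?thesis
      by (simp flip: iota_mult mult.assoc)
  qed
  \<comment> \<open>The value 1/6 makes z^3/3 equal to -c/6 for c = -2 z^3, where V = c N. Hence V -
    z^3/3 = c (N + 1/6), and 2\<rho> = 1/3 is not an integer.\<close>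
  interpret heis_pair iota N q "1 / 6"
  proof unfold_locales
    show "2 * (1 / 6) \<notin> (\<int> :: 'k set)"
    proof
      assume "2 * (1 / 6) \<in> (\<int> :: 'k set)"
      then obtain n where "2 * (1 / 6) = (of_int n :: 'k)"
        by (auto elim: Ints_cases)
      then have "of_int (3 * n) = (of_int 1 :: 'k)"
        by (simp add: field_simps)
      then have "3 * n = 1"
        by (simp only: of_int_eq_iff)
      then show False by presburger
    qed
  qed (use Nq q0 in auto)
  define A where "A = x * y + y * x"
  have zA: "z * A = A * z"
    unfolding A_def distrib_left distrib_right by (metis zx zy mult.assoc)
  have zAb: "z * (A * b) = A * (z * b)" for b
    by (metis zA mult.assoc)
  have zN: "z * N = N * z"
    unfolding N_def A_def[symmetric] iota_left_commute[of z] mult.assoc zAb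
    by (simp add: ziz)
  define c where "c = iota (- 2) * z ^ 3"
  have c0: "c \<noteq> 0"
    using z0 by (simp add: c_def)
  have V: "heis_V iota x y = c * N"
  proof -
    have "c * N = iota (- 2) * (iota (- 1 / 4) * (z ^ 3 * (A * zi)))"
      unfolding c_def N_def A_def[symmetric] by (simp only: mult.assoc iota_left_commute[of "z ^ 3"])
    also have "\<dots> = iota (1 / 2) * (z ^ 3 * (A * zi))"
      by (simp flip: mult.assoc iota_mult)
    also have "z ^ 3 * (A * zi) = z * A * z"
      by (simp add: eval_nat_numeral mult.assoc zAb ziz zA)
    finally show ?thesis
      by (simp add: heis_V_def z_def A_def mult.assoc)
  qed
  have Vm: "heis_Vm iota x y = c * (N - iota (\<rho>s False))"
    and Vp: "heis_Vp iota x y = c * (N - iota (\<rho>s True))"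
  proof -
    have "c * iota (1 / 6) = iota (1 / 6) * c"
      by (rule iota_commute[symmetric])
    also have "\<dots> = iota (- 1 / 3) * z ^ 3"
      by (simp add: c_def flip: mult.assoc iota_mult)
    finally have c6: "c * iota (1 / 6) = - (iota (1 / 3) * z ^ 3)"
      by (simp add: iota_minus)
    show "heis_Vm iota x y = c * (N - iota (\<rho>s False))"
      and "heis_Vp iota x y = c * (N - iota (\<rho>s True))"
      by (simp_all add: heis_Vm_def heis_Vp_def V z_def[symmetric] \<rho>s_def right_diff_distrib
          distrib_left iota_minus c6)
  qed
  have Vm0: "heis_Vm iota x y \<noteq> 0" and Vp0: "heis_Vp iota x y \<noteq> 0"
    unfolding Vm Vp by (intro no_zero_divisors c0 N_minus_iota_nonzero)+
  have zy2: "z * y\<^sup>2 = y\<^sup>2 * z"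
    by (metis zy mult.assoc power2_eq_square)
  have zp: "z + y\<^sup>2 = (1 + q) * z" and zm: "z - y\<^sup>2 = (1 - q) * z"
    by (simp_all add: q_def distrib_right left_diff_distrib mult.assoc ziz)
  have zq: "z * q = q * z"
  proof -
    have "z * q = y\<^sup>2 * z * zi"
      by (simp only: q_def zy2[symmetric] mult.assoc)
    then show ?thesis
      by (simp add: q_def mult.assoc ziz)
  qed
  \<comment> \<open>The factor z is taken out on either side: one quotient in T cancels it on the
    left, the other on the right.\<close>
  have zp': "z + y\<^sup>2 = z * (1 + q)" and zm': "z - y\<^sup>2 = z * (1 - q)"
    by (simp_all add: zp zm distrib_left distrib_right left_diff_distrib right_diff_distrib zq)
  have zp0: "z + y\<^sup>2 \<noteq> 0" and zm0: "z - y\<^sup>2 \<noteq> 0"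
    unfolding zp zm by (intro no_zero_divisors z0 one_minus_q_nonzero one_plus_q_nonzero)+
  have quot_right: "a * d * inverse (b * d) = a * inverse b"
    and quot_left: "inverse (d * a) * (d * b) = inverse a * b"
    if "a \<noteq> 0" "b \<noteq> 0" "d \<noteq> 0" for a b d :: 'd
  proof -
    show "a * d * inverse (b * d) = a * inverse b"
      using that by (simp add: nonzero_inverse_mult_distrib mult.assoc) (simp flip: mult.assoc)
    show "inverse (d * a) * (d * b) = inverse a * b"
      using that by (simp add: nonzero_inverse_mult_distrib mult.assoc) (simp flip: mult.assoc)
  qed
  have cN: "c * (N - iota d) = (N - iota d) * c" for d
  proof -
    have "z ^ 3 * N = N * z ^ 3"
      by (simp add: eval_nat_numeral mult.assoc zN) (metis zN mult.assoc)
    then have "c * N = N * c"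
      unfolding c_def by (simp add: mult.assoc iota_left_commute[of N])
    then show ?thesis
      by (simp add: right_diff_distrib left_diff_distrib iota_commute[of d c])
  qed
  have S: "heis_S iota x y = S"
  proof -
    let ?m = "N - iota (\<rho>s False)" and ?p = "N - iota (\<rho>s True)"
    \<comment> \<open>The two factors \<open>?m\<close> and \<open>?p\<close> differ by 1/3, so each
      quotient is 1 plus or minus one third of a G, and S takes the form 2 + (G True - G False) /
      3.\<close>
    have "iota (1 / 3) = iota (1 / 6) + iota (1 / 6)"
      by (simp flip: iota_add)
    then have mp: "?m = ?p + iota (1 / 3)" "?p = ?m - iota (1 / 3)"
      by (simp_all add: \<rho>s_def iota_minus)
    have "heis_S iota x y = ?m * inverse ?p + inverse ?m * ?p"
      unfolding heis_S_def Vm Vp quot_left[OF N_minus_iota_nonzero N_minus_iota_nonzero c0]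
      unfolding cN quot_right[OF N_minus_iota_nonzero N_minus_iota_nonzero c0] ..
    also have "?m * inverse ?p = (?p + iota (1 / 3)) * G True"
      unfolding G_def mp(1) ..
    also have "\<dots> = 1 + iota (1 / 3) * G True"
      using N_minus_iota_nonzero by (simp add: distrib_right G_def)
    also have "inverse ?m * ?p = G False * (?m - iota (1 / 3))"
      unfolding G_def mp(2) ..
    also have "\<dots> = 1 - iota (1 / 3) * G False"
    proof -
      have "G False * ?m = 1"
        unfolding G_def by (rule left_inverse[OF N_minus_iota_nonzero])
      then show ?thesis
        by (simp only: right_diff_distrib[of "G False" ?m] iota_commute)
    qed
    finally show ?thesis
      by (simp add: S_def right_diff_distrib)
  qed
  have T: "heis_T iota x y = T"
  proof -
    have "u = inverse (1 - q) * (1 + q)"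
      unfolding u_def by (rule inverse_commute[symmetric]) (simp add: algebra_simps)
    then have u: "inverse u = inverse (1 + q) * (1 - q)"
      using one_minus_q_nonzero one_plus_q_nonzero by (simp only: nonzero_inverse_mult_distrib
          nonzero_imp_inverse_nonzero nonzero_inverse_inverse_eq not_False_eq_True)
    have "heis_T iota x y = (inverse (z + y\<^sup>2) * (z - y\<^sup>2)) * S * ((z + y\<^sup>2) * inverse (z - y\<^sup>2))"
      by (simp only: heis_T_def S z_def mult.assoc)
    also have "inverse (z + y\<^sup>2) * (z - y\<^sup>2) = inverse u"
      unfolding zp' zm' u by (rule quot_left[OF one_plus_q_nonzero one_minus_q_nonzero z0])
    also have "(z + y\<^sup>2) * inverse (z - y\<^sup>2) = u"
      unfolding zp zm u_def by (rule quot_right[OF one_plus_q_nonzero one_minus_q_nonzero z0])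
    finally show ?thesis
      by (simp only: T_def)
  qed
  have "star (heis_S iota x y) = heis_S iota x y \<and> star (heis_T iota x y) = heis_T iota x y"
    if "principal_involution iota x y star" for star
    using principal_involution_fixes[OF ce that] by blast
  then show ?thesis
    using Vm0 Vp0 zp0 zm0 words_independent unfolding z_def S T by blast
qed

end
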